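(* Let $(X^{(a)}(t))_{t\ge 0}$, $a\in\ell\setminus\{0\}$, be a family of irreducible discrete time birth and death chains on rooted trees $I_a$, indexed by the non-root vertices $a$ of an infinite path $\ell$ starting at the root, and suppose the family satisfies the $0^{\ell}$-SD condition (strong drift toward $0$ along the path $\ell$). Suppose moreover that there exist finite constants $K$, $K'$ and a constant $K'_\mu>0$ such that for all $a\in\ell\setminus\{0\}$ $$\frac{\sup_{x\in I_a}\mathbb{E}\left[T^{(a)}_{x\to 0}\right]}{\mathbb{E}\left[T^{(a)}_{a\to 0}\right]}\le K,\qquad \frac{(K'_a)^2}{\mathbb{E}\left[T^{(a)}_{a\to 0}\right]}\le K',\qquad \inf_{b\in I_a\setminus\{0\}}\mu^{(a)}_b\ge K'_\mu ,$$ where $$K'_a=\sup_{b\in I_a\setminus\{0\}}\mu^{(a)}_b\,\mathbb{E}\left[T^{(a)}_{b\to p(b)}\right].$$ Then, as $a\to\infty$: 1. the random variables $T^{(a)}_{a\to 0}$ exhibit cut-off behavior at mean times; 2. the random variables $T^{(a)}_{0\to a}$ exhibit escape-time behavior at mean times.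
   Context: Tree notation. A tree is a connected undirected graph without cycles; one vertex, denoted $0$, is chosen as root. For a tree with vertex set $I$, put $J=I\setminus\{0\}$. Write $x\preceq y$ if $x$ lies on the path from $y$ to $0$ (including $x=y$). Each $x\in J$ has a unique parent $p(x)$ (the neighbor of $x$ with $p(x)\preceq x$). $d(x)$ is the length of the path from $x$ to $0$; $\ell(x)=\{x_0,x_1,\dots,x_{d(x)-1}\}$ with $x_i=p^i(x)$ is the set of vertices on that path except $0$; $\alpha(x)=x_{d(x)-1}$ is the last vertex before $0$ on that path. $\sigma(x)=\{y: p(y)=x\}$ is the set of children of $x$ and $B_x=\{y: x\preceq y\}$ is the branch stemming from $x$. Chains. A birth and death chain on $I$ is a Markov chain $X(t)$, $t=0,1,2,\dots$, with transition probabilities $\lambda_x=P(p(x),x)>0$ and $\mu_x=P(x,p(x))>0$ for $x\in J$, and possibly waiting probabilities $\kappa_x=P(x,x)\ge 0$ for $x\in I$, all other transition probabilities being $0$; thus $\mu_x+\kappa_x+\sum_{y\in\sigma(x)}\lambda_y=1$ for $x\in J$ and $\kappa_0+\sum_{x\in\sigma(0)}\lambda_x=1$. If $I$ is infinite, it is assumed that $\sum_{x\in I}\prod_{y\in\ell(x)}\lambda_y/\mu_y<\infty$. The chain is then positive recurrent with unique (reversible) invariant probability measure $\pi(x)=\pi(0)\prod_{y\in\ell(x)}\lambda_y/\mu_y$. Hitting times: $T_{x\to y}=\min\{t\ge 0: X^x(t)=y\}$, where $X^x$ is the chain started at $x$. Families. $\ell$ is an infinite path $0=v_0,v_1,v_2,\dots$.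 For each $a=v_n$ with $n\ge 1$, $I_a$ is a tree rooted at $0$ containing the vertices $v_0,\dots,v_n$ with $p(v_k)=v_{k-1}$ for $1\le k\le n$ (so $d(a)=n$ and $\ell(a)=\{v_1,\dots,v_n\}$), and $X^{(a)}$ is a birth and death chain on $I_a$, that is, a Markov chain on $I_a$ with transition probabilities $\lambda^{(a)}_x=P^{(a)}(p(x),x)>0$ and $\mu^{(a)}_x=P^{(a)}(x,p(x))>0$ for $x\in I_a\setminus\{0\}$, possibly waiting probabilities $\kappa^{(a)}_x=P^{(a)}(x,x)\ge 0$ for $x\in I_a$, and all other transition probabilities equal to $0$, satisfying $\sum_{x\in I_a}\prod_{y\in\ell(x)}\lambda^{(a)}_y/\mu^{(a)}_y<\infty$ if $I_a$ is infinite. Quantities of $X^{(a)}$ carry the superscript $(a)$; branches are taken in $I_a$. The transition probabilities may depend on $a$. "$a\to\infty$" means $a\in\ell$ and $d(a)\to\infty$. $0^\ell$-SD condition. (i) There is a constant $K_\mu>0$ such that $\inf_{b\in B_{\alpha(a)}}\mu^{(a)}_b\ge K_\mu$ for all $a\in\ell\setminus\{0\}$; (ii) the quantity $K_a=\sup_{b\in B_{\alpha(a)}}\mu^{(a)}_b\,\mathbb{E}[T^{(a)}_{b\to p(b)}]$ satisfies $K_a^2/\mathbb{E}[T^{(a)}_{a\to 0}]\to 0$ as $a\to\infty$. (Equivalently $K_a=\sup_{b\in B_{\alpha(a)}}\pi^{(a)}(B_b)/\pi^{(a)}(b)$.) Cut-off and escape. A family of random variables $U^{(a)}$ exhibits cut-off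 behavior at mean times if $U^{(a)}/\mathbb{E}[U^{(a)}]\to 1$ in probability as $a\to\infty$. A family of random variables $V^{(a)}$ exhibits escape-time behavior at mean times if $V^{(a)}/\mathbb{E}[V^{(a)}]$ converges in law, as $a\to\infty$, to the exponential distribution with mean $1$. *)

theory Defs
  imports "HOL-Probability.Probability"
begin

section \<open>Rooted trees\<close>

record 'v rooted_graph =
  verts :: "'v set"
  edges :: "'v set set"
  origin :: 'v

definition walk :: "('v, 'm) rooted_graph_scheme \<Rightarrow> 'v list \<Rightarrow> bool" where
  "walk G xs \<longleftrightarrow> xs \<noteq> [] \<and> set xs \<subseteq> verts G \<and> successively (\<lambda>x y. {x, y} \<in> edges G) xs"

definition path_between :: "('v, 'm) rooted_graph_scheme \<Rightarrow> 'v \<Rightarrow> 'v list \<Rightarrow> 'v \<Rightarrow> bool" where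
  "path_between G x xs y \<longleftrightarrow> walk G xs \<and> distinct xs \<and> hd xs = x \<and> last xs = y"

definition graph_cycle :: "('v, 'm) rooted_graph_scheme \<Rightarrow> 'v list \<Rightarrow> bool" where
  "graph_cycle G xs \<longleftrightarrow> walk G xs \<and> distinct xs \<and> 3 \<le> length xs \<and> {last xs, hd xs} \<in> edges G"

definition rooted_tree :: "('v, 'm) rooted_graph_scheme \<Rightarrow> bool" where
  "rooted_tree G \<longleftrightarrow>
     origin G \<in> verts G \<and>
     (\<forall>e\<in>edges G. \<exists>x\<in>verts G. \<exists>y\<in>verts G. x \<noteq> y \<and> e = {x, y}) \<and>
     (\<forall>x\<in>verts G. \<forall>y\<in>verts G. \<exists>xs. path_between G x xs y) \<and>
     (\<nexists>xs. graph_cycle G xs)"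

text \<open>The definitions below are meaningful when \<^term>\<open>rooted_tree G\<close> holds and the vertices lie
  in \<^term>\<open>verts G\<close>; then the path to the root exists and is unique.\<close>

definition root_path :: "('v, 'm) rooted_graph_scheme \<Rightarrow> 'v \<Rightarrow> 'v list" where
  "root_path G y = (THE xs. path_between G y xs (origin G))"

definition tree_le :: "('v, 'm) rooted_graph_scheme \<Rightarrow> 'v \<Rightarrow> 'v \<Rightarrow> bool" where
  "tree_le G x y \<longleftrightarrow> x \<in> set (root_path G y)"

definition parent :: "('v, 'm) rooted_graph_scheme \<Rightarrow> 'v \<Rightarrow> 'v" where
  "parent G x = (THE y. {x, y} \<in> edges G \<and> tree_le G y x)"

definition depth :: "('v, 'm) rooted_graph_scheme \<Rightarrow> 'v \<Rightarrow> nat" where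
  "depth G x = length (root_path G x) - 1"

definition ell :: "('v, 'm) rooted_graph_scheme \<Rightarrow> 'v \<Rightarrow> 'v set" where
  "ell G x = (\<lambda>i. (parent G ^^ i) x) ` {..<depth G x}"

definition alpha :: "('v, 'm) rooted_graph_scheme \<Rightarrow> 'v \<Rightarrow> 'v" where
  "alpha G x = (parent G ^^ (depth G x - 1)) x"

definition branch :: "('v, 'm) rooted_graph_scheme \<Rightarrow> 'v \<Rightarrow> 'v set" where
  "branch G x = {y \<in> verts G. tree_le G x y}"

definition non_root :: "('v, 'm) rooted_graph_scheme \<Rightarrow> 'v set" where
  "non_root G = verts G - {origin G}"

section \<open>Birth and death chains\<close>

text \<open>The row of the transition matrix at \<^term>\<open>x\<close> is a \<^typ>\<open>'v pmf\<close>, so that it sums to one;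
  the waiting probability at \<^term>\<open>x\<close> is \<^term>\<open>pmf (trans_pmf C x) x\<close>.\<close>

record 'v bd_chain = "'v rooted_graph" +
  trans_pmf :: "'v \<Rightarrow> 'v pmf"

definition birth :: "'v bd_chain \<Rightarrow> 'v \<Rightarrow> real" where
  "birth C x = pmf (trans_pmf C (parent C x)) x"

definition death :: "'v bd_chain \<Rightarrow> 'v \<Rightarrow> real" where
  "death C x = pmf (trans_pmf C x) (parent C x)"

definition birth_death_chain :: "'v bd_chain \<Rightarrow> bool" where
  "birth_death_chain C \<longleftrightarrow>
     rooted_tree C \<and>
     (\<forall>x\<in>non_root C. birth C x > 0 \<and> death C x > 0) \<and>
     (\<forall>x\<in>verts C. \<forall>y.
        \<not> (y = x \<or> x \<in> non_root C \<and> y = parent C x \<or> y \<in> non_root C \<and> x = parent C y) \<longrightarrow>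
        pmf (trans_pmf C x) y = 0) \<and>
     (infinite (verts C) \<longrightarrow> (\<lambda>x. \<Prod>y\<in>ell C x. birth C y / death C y) summable_on verts C)"

text \<open>\<^term>\<open>X\<close> is the chain started at \<^term>\<open>x\<close>, realised on the probability space \<^term>\<open>M\<close>.\<close>

definition chain_from :: "'v bd_chain \<Rightarrow> 'v \<Rightarrow> 'w measure \<Rightarrow> (nat \<Rightarrow> 'w \<Rightarrow> 'v) \<Rightarrow> bool" where
  "chain_from C x M X \<longleftrightarrow>
     prob_space M \<and>
     (\<forall>t. X t \<in> measurable M (count_space (verts C))) \<and>
     \<P>(\<omega> in M. X 0 \<omega> = x) = 1 \<and>
     (\<forall>t h y. \<P>(\<omega> in M. \<forall>s\<le>t. X s \<omega> = h s) > 0 \<longrightarrow>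
        \<P>(\<omega> in M. X (Suc t) \<omega> = y \<bar> \<forall>s\<le>t. X s \<omega> = h s) = pmf (trans_pmf C (h t)) y)"

definition hitting_time :: "(nat \<Rightarrow> 'w \<Rightarrow> 'v) \<Rightarrow> 'v \<Rightarrow> 'w \<Rightarrow> enat" where
  "hitting_time X y \<omega> = (INF t\<in>{t. X t \<omega> = y}. enat t)"

section \<open>Families of chains along an infinite path\<close>

text \<open>\<^term>\<open>C a\<close> is the chain with index \<^term>\<open>a\<close>, and \<^term>\<open>X a x\<close> on \<^term>\<open>M a x\<close> is an arbitrary
  realisation of \<^term>\<open>C a\<close> started at \<^term>\<open>x\<close>. The value of \<^term>\<open>C\<close> at the root \<^term>\<open>v 0\<close>
  is irrelevant. Since the depth of \<^term>\<open>v n\<close> in \<^term>\<open>C (v n)\<close> is \<^term>\<open>n\<close>, limits as the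
  index runs to infinity along the path are sequential limits in \<^term>\<open>n\<close> for the index
  \<^term>\<open>v n\<close>.\<close>

locale bd_family =
  fixes v :: "nat \<Rightarrow> 'v"
    and C :: "'v \<Rightarrow> 'v bd_chain"
    and M :: "'v \<Rightarrow> 'v \<Rightarrow> 'w measure"
    and X :: "'v \<Rightarrow> 'v \<Rightarrow> nat \<Rightarrow> 'w \<Rightarrow> 'v"
  assumes inj_v: "inj v"
    and chain: "n \<ge> 1 \<Longrightarrow> birth_death_chain (C (v n))"
    and origin_v: "n \<ge> 1 \<Longrightarrow> origin (C (v n)) = v 0"
    and path_in: "n \<ge> 1 \<Longrightarrow> k \<le> n \<Longrightarrow> v k \<in> verts (C (v n))"
    and path_parent: "1 \<le> k \<Longrightarrow> k \<le> n \<Longrightarrow> parent (C (v n)) (v k) = v (k - 1)"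
    and realisation: "n \<ge> 1 \<Longrightarrow> x \<in> verts (C (v n)) \<Longrightarrow>
          chain_from (C (v n)) x (M (v n) x) (X (v n) x)"

definition hit :: "('v \<Rightarrow> 'v \<Rightarrow> nat \<Rightarrow> 'w \<Rightarrow> 'v) \<Rightarrow> 'v \<Rightarrow> 'v \<Rightarrow> 'v \<Rightarrow> 'w \<Rightarrow> ennreal" where
  "hit X a x y \<omega> = ennreal_of_enat (hitting_time (X a x) y \<omega>)"

definition mean_hit ::
  "('v \<Rightarrow> 'v \<Rightarrow> 'w measure) \<Rightarrow> ('v \<Rightarrow> 'v \<Rightarrow> nat \<Rightarrow> 'w \<Rightarrow> 'v) \<Rightarrow> 'v \<Rightarrow> 'v \<Rightarrow> 'v \<Rightarrow> ennreal" where
  "mean_hit M X a x y = (\<integral>\<^sup>+\<omega>. hit X a x y \<omega> \<partial>M a x)"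

text \<open>With \<^term>\<open>A\<close> the branch at \<^term>\<open>alpha (C a) a\<close> this is the constant in the strong drift
  condition; with \<^term>\<open>A\<close> all non-root vertices it is its primed version.\<close>

definition drift_sup ::
  "('v \<Rightarrow> 'v bd_chain) \<Rightarrow> ('v \<Rightarrow> 'v \<Rightarrow> 'w measure) \<Rightarrow> ('v \<Rightarrow> 'v \<Rightarrow> nat \<Rightarrow> 'w \<Rightarrow> 'v) \<Rightarrow>
   'v \<Rightarrow> 'v set \<Rightarrow> ennreal" where
  "drift_sup C M X a A = (SUP b\<in>A. ennreal (death (C a) b) * mean_hit M X a b (parent (C a) b))"

definition strong_drift ::
  "(nat \<Rightarrow> 'v) \<Rightarrow> ('v \<Rightarrow> 'v bd_chain) \<Rightarrow> ('v \<Rightarrow> 'v \<Rightarrow> 'w measure) \<Rightarrow>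
   ('v \<Rightarrow> 'v \<Rightarrow> nat \<Rightarrow> 'w \<Rightarrow> 'v) \<Rightarrow> bool" where
  "strong_drift v C M X \<longleftrightarrow>
     (\<exists>K\<mu>::real. K\<mu> > 0 \<and>
        (\<forall>a\<in>range v - {v 0}. (INF b\<in>branch (C a) (alpha (C a) a). death (C a) b) \<ge> K\<mu>)) \<and>
     (\<lambda>n. let a = v n in
        (drift_sup C M X a (branch (C a) (alpha (C a) a)))\<^sup>2 / mean_hit M X a a (v 0))
       \<longlonglongrightarrow> 0"

section \<open>Cut-off and escape\<close>

text \<open>The quotient is formed in \<^typ>\<open>ennreal\<close>. If the mean is finite, \<^term>\<open>U\<close> is almost surely
  finite and the conversion to \<^typ>\<open>real\<close> loses nothing; if it is infinite, the quotient is
  identically zero and neither of the two properties below can hold.\<close>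

definition mean_scaled :: "'w measure \<Rightarrow> ('w \<Rightarrow> ennreal) \<Rightarrow> 'w \<Rightarrow> real" where
  "mean_scaled M U \<omega> = enn2real (U \<omega> / (\<integral>\<^sup>+\<xi>. U \<xi> \<partial>M))"

definition cutoff_at_mean_times ::
  "(nat \<Rightarrow> 'w measure) \<Rightarrow> (nat \<Rightarrow> 'w \<Rightarrow> ennreal) \<Rightarrow> bool" where
  "cutoff_at_mean_times M U \<longleftrightarrow>
     (\<forall>\<epsilon>>0. (\<lambda>n. \<P>(\<omega> in M n. \<bar>mean_scaled (M n) (U n) \<omega> - 1\<bar> > \<epsilon>)) \<longlonglongrightarrow> 0)"

definition escape_at_mean_times ::
  "(nat \<Rightarrow> 'w measure) \<Rightarrow> (nat \<Rightarrow> 'w \<Rightarrow> ennreal) \<Rightarrow> bool" where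
  "escape_at_mean_times M V \<longleftrightarrow>
     weak_conv_m (\<lambda>n. distr (M n) borel (mean_scaled (M n) (V n)))
       (density lborel (exponential_density 1))"

end

theory Submission
  imports Defs
begin

text \<open>Everything is expressed through the survival probabilities of the transition kernel: with z made
absorbing, the probability of not having met z by time t satisfies a one-step recursion in the
starting point, and the moments of the hitting time are weighted sums of these probabilities. Hence
every comparison of hitting times is an induction on time, and a realisation of the chain enters only
through the survival probabilities.

Write 0 for the root, G for the mean time from a to 0 and m for the mean time from 0 to a.

Cut-off. Let h(x) be the mean time from x to 0. On a tree the path from x to 0 goes through the parent of
x, so h changes along an edge by the mean time to step from its lower end to the upper one. Under the drift
condition these increments are at most c = K_a / K_mu on the branch that carries a. The process
h(X_t) + t is a martingale until the root is reached, with conditional variances at most c^2, so the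
variance of the hitting time is at most c^2 G (second_moment_le). As c^2 / G tends to 0, Chebyshev's
inequality gives the cut-off.

Escape. Two facts suffice. First, G / m tends to 0. Number the vertices of the path 0, 1, ..., n, let w_i
be the mean time from i to i - 1 and r_i the mean time from i - 1 to i. Conditioning on the first
step relates consecutive values of w and of r, and the two relations together make r_i / w_i + 1 grow at
least like exp((i - 1) / K_a) (reverse_drift_growth). The first j K_a + 1 indices contribute only
O(j K_a^2) to G, the sum of the w_i, which is negligible against G; hence m, the sum of the r_i, is
eventually at least (e^j - 1)/2 times G, for every j (reverse_drift_sum, ratio_tendsto_0).

Second, by hypothesis the root is reached from anywhere in mean time R = O(G), which is now o(m). So
the chain renews itself at the root long before it sees a, and the time to reach a forgets its past.
In terms of the survival function f of that time and of its tail sums I(t) = f(t) + f(t+1) + ..., where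
I(0) = m, this reads I(t) <= (m + R) f(t) and m f(t + u) <= m R / (u + 1) + I(t) (tail_time_le,
survive_le_tail_time). Since f is the decrement of I, these are two difference inequalities; they
squeeze f(floor(y m)) to e^(-y) when u is chosen of order sqrt(R m) (survival_bounds,
survival_tendsto_exp).

The means are finite by reversibility: a flow balance with the invariant measure bounds the mean time
to step across an edge in either direction by the total mass divided by the weight of the edge
(reversible_mean_time).\<close>


section \<open>Hitting times of a Markov kernel\<close>

text \<open>The probability that the chain with kernel P started at x has not met z up to and including time t.\<close>

primrec survive :: "('v \<Rightarrow> 'v pmf) \<Rightarrow> 'v \<Rightarrow> nat \<Rightarrow> 'v \<Rightarrow> ennreal" where
  "survive P z 0 x = (if x = z then 0 else 1)"
| "survive P z (Suc t) x = (if x = z then 0 else \<integral>\<^sup>+y. survive P z t y \<partial>measure_pmf (P x))"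

definition mean_time :: "('v \<Rightarrow> 'v pmf) \<Rightarrow> 'v \<Rightarrow> 'v \<Rightarrow> ennreal" where
  "mean_time P z x = (\<Sum>t. survive P z t x)"

lemma survive_target [simp]: "survive P z t z = 0"
  by (cases t) auto

lemma survive_le_one: "survive P z t x \<le> 1"
proof (induction t arbitrary: x)
  case (Suc t)
  have "(\<integral>\<^sup>+y. survive P z t y \<partial>measure_pmf (P x)) \<le> (\<integral>\<^sup>+y. 1 \<partial>measure_pmf (P x))"
    by (intro nn_integral_mono Suc)
  then show ?case by simp
qed simp

lemma survive_Suc_le: "survive P z (Suc t) x \<le> survive P z t x"
proof (induction t arbitrary: x)
  case 0
  show ?case using survive_le_one[of P z "Suc 0" x] by (cases "x = z") auto
next
  case (Suc t)
  then show ?case by (auto intro!: nn_integral_mono simp del: survive.simps(2) simp: survive.simps(2)[of P z "Suc t"] survive.simps(2)[of P z t])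
qed

lemma survive_antimono: "s \<le> t \<Longrightarrow> survive P z t x \<le> survive P z s x"
  by (rule lift_Suc_antimono_le[of "\<lambda>t. survive P z t x"]) (auto intro: survive_Suc_le simp del: survive.simps)

lemma mean_time_target [simp]: "mean_time P z z = 0"
  by (simp add: mean_time_def)

lemma suminf_Suc_ennreal: "(\<Sum>t. f t) = f 0 + (\<Sum>t. f (Suc t))" for f :: "nat \<Rightarrow> ennreal"
  using suminf_offset[of f 1] by simp

lemma mean_time_first_step:
  assumes "x \<noteq> z"
  shows "mean_time P z x = 1 + (\<integral>\<^sup>+y. mean_time P z y \<partial>measure_pmf (P x))"
  using assms unfolding mean_time_def by (subst suminf_Suc_ennreal) (simp add: nn_integral_suminf)

lemma one_le_mean_time: "x \<noteq> z \<Longrightarrow> 1 \<le> mean_time P z x"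
  by (simp add: mean_time_first_step)

lemma nn_integral_pmf_mono:
  assumes "\<And>y. y \<in> set_pmf p \<Longrightarrow> f y \<le> g y"
  shows "(\<integral>\<^sup>+y. f y \<partial>measure_pmf p) \<le> (\<integral>\<^sup>+y. g y \<partial>measure_pmf p)"
  using assms by (intro nn_integral_mono_AE) (simp add: AE_measure_pmf_iff)

lemma nn_integral_pmf_add_const:
  "(\<integral>\<^sup>+y. f y + c \<partial>measure_pmf p) = (\<integral>\<^sup>+y. f y \<partial>measure_pmf p) + c" for c :: ennreal
  by (simp add: nn_integral_add)

text \<open>The mean hitting time is the least nonnegative solution of its first-step equation, here with
boundary values on B: the partial sums of the survival probabilities, which are means of truncated
hitting times, stay below any supersolution by induction on the truncation.\<close>

lemma mean_time_le_supersolution: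
  fixes U :: "'v \<Rightarrow> ennreal"
  assumes closed: "\<And>x. x \<in> A \<Longrightarrow> set_pmf (P x) \<subseteq> A \<union> B"
    and super: "\<And>x. x \<in> A \<Longrightarrow> x \<noteq> z \<Longrightarrow> 1 + (\<integral>\<^sup>+y. U y \<partial>measure_pmf (P x)) \<le> U x"
    and boundary: "\<And>y. y \<in> B \<Longrightarrow> mean_time P z y \<le> U y"
    and "x \<in> A"
  shows "mean_time P z x \<le> U x"
proof -
  have "(\<Sum>t<N. survive P z t x) \<le> U x" if "x \<in> A \<union> B" for N x
    using that
  proof (induction N arbitrary: x)
    case (Suc N)
    consider "x \<in> B" | "x = z" | "x \<in> A" "x \<noteq> z" using Suc.prems by auto
    then show ?case
    proof cases
      case 1
      have "(\<Sum>t<Suc N. survive P z t x) \<le> mean_time P z x"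
        unfolding mean_time_def by (intro sum_le_suminf) auto
      then show ?thesis using boundary[OF 1] by (rule order_trans)
    next
      case 3
      have "(\<Sum>t<Suc N. survive P z t x) = 1 + (\<Sum>t<N. survive P z (Suc t) x)"
        using 3 by (simp add: sum.lessThan_Suc_shift del: sum.lessThan_Suc)
      also have "\<dots> = 1 + (\<integral>\<^sup>+y. (\<Sum>t<N. survive P z t y) \<partial>measure_pmf (P x))"
        using 3 by (simp add: nn_integral_sum)
      also have "\<dots> \<le> 1 + (\<integral>\<^sup>+y. U y \<partial>measure_pmf (P x))"
        using Suc.IH closed[OF 3(1)] by (intro add_left_mono nn_integral_pmf_mono) auto
      also have "\<dots> \<le> U x" by (rule super[OF 3])
      finally show ?thesis .
    qed simp
  qed simp
  then show ?thesis
    using \<open>x \<in> A\<close> unfolding mean_time_def by (intro suminf_le_const) auto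
qed

definition gate :: "('v \<Rightarrow> 'v pmf) \<Rightarrow> 'v set \<Rightarrow> 'v \<Rightarrow> bool" where
  "gate P A z \<longleftrightarrow> z \<notin> A \<and> (\<forall>x\<in>A. set_pmf (P x) \<subseteq> insert z A)"

text \<open>From inside A the target w outside A cannot be met before z, and survival decreases with time.\<close>

lemma survive_gate_mono:
  assumes "gate P A z" "w \<notin> A" "x \<in> A"
  shows "survive P w t z \<le> survive P w t x"
  using \<open>x \<in> A\<close>
proof (induction t arbitrary: x)
  case 0
  then show ?case using assms by auto
next
  case (Suc t)
  have "survive P w (Suc t) z \<le> (\<integral>\<^sup>+y. survive P w t z \<partial>measure_pmf (P x))"
    using survive_Suc_le[of P w t z] by simp
  also have "\<dots> \<le> (\<integral>\<^sup>+y. survive P w t y \<partial>measure_pmf (P x))"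
    using Suc assms by (intro nn_integral_pmf_mono) (auto simp: gate_def)
  also have "\<dots> = survive P w (Suc t) x" using Suc.prems assms by auto
  finally show ?case .
qed

lemma mean_time_gate_mono:
  assumes "gate P A z" "w \<notin> A" "x \<in> A"
  shows "mean_time P w z \<le> mean_time P w x"
  unfolding mean_time_def by (intro suminf_le survive_gate_mono[OF assms]) auto

text \<open>The time from x to w splits at the first visit to z. Both
sides solve the same first-step equation on A, and each inequality compares the truncations of one side
with the full other side.\<close>

lemma mean_time_gate:
  assumes "gate P A z" "w \<notin> A" "x \<in> A"
  shows "mean_time P w x = mean_time P z x + mean_time P w z"
proof (rule antisym)
  show "mean_time P w x \<le> mean_time P z x + mean_time P w z"
  proof (rule mean_time_le_supersolution[where A = A and B = "{z}"])
    fix x assume "x \<in> A"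
    with assms have "x \<noteq> z" by (auto simp: gate_def)
    then show "1 + (\<integral>\<^sup>+y. mean_time P z y + mean_time P w z \<partial>measure_pmf (P x))
        \<le> mean_time P z x + mean_time P w z"
      by (simp add: mean_time_first_step[of x z] nn_integral_add add_ac)
  qed (use assms in \<open>auto simp: gate_def\<close>)
  have "(\<Sum>t<N. survive P z t x) + mean_time P w z \<le> mean_time P w x" if "x \<in> A" for N x
    using that
  proof (induction N arbitrary: x)
    case 0
    then show ?case using mean_time_gate_mono[OF assms(1,2)] by simp
  next
    case (Suc N)
    have "x \<noteq> z" "x \<noteq> w" using assms Suc.prems by (auto simp: gate_def)
    then have "(\<Sum>t<Suc N. survive P z t x) + mean_time P w z
        = 1 + (\<integral>\<^sup>+y. (\<Sum>t<N. survive P z t y) + mean_time P w z \<partial>measure_pmf (P x))"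
      by (simp add: sum.lessThan_Suc_shift nn_integral_sum nn_integral_add add_ac del: sum.lessThan_Suc)
    also have "\<dots> \<le> 1 + (\<integral>\<^sup>+y. mean_time P w y \<partial>measure_pmf (P x))"
    proof (intro add_left_mono nn_integral_pmf_mono)
      fix y assume "y \<in> set_pmf (P x)"
      then have "y = z \<or> y \<in> A" using assms Suc.prems by (auto simp: gate_def)
      then show "(\<Sum>t<N. survive P z t y) + mean_time P w z \<le> mean_time P w y"
        using Suc.IH by auto
    qed
    also have "\<dots> = mean_time P w x" using \<open>x \<noteq> w\<close> by (simp add: mean_time_first_step)
    finally show ?case .
  qed
  then have "(\<Sum>t. survive P z t x + 0) + mean_time P w z \<le> mean_time P w x"
    using assms(3)
    by (subst suminf_eq_SUP, subst ennreal_SUP_add_left[symmetric]) (auto intro!: SUP_least)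
  then show "mean_time P z x + mean_time P w z \<le> mean_time P w x"
    by (simp add: mean_time_def)
qed

lemma nn_integral_pmf_indicator_eq:
  "(\<integral>\<^sup>+y. c * indicator {z} y \<partial>measure_pmf p) = c * ennreal (pmf p z)" for c :: ennreal
  by (simp add: nn_integral_cmult emeasure_pmf_single)

text \<open>The first-step equation at x, with the unknown mean times from the other neighbours replaced by lower
bounds: stepping anywhere except to z or c returns at least to the starting level, stepping to c costs g
more.\<close>

lemma drift_recursion:
  assumes "x \<noteq> z" "c \<noteq> z" and finite: "mean_time P z x < \<infinity>"
    and far: "\<And>y. y \<in> set_pmf (P x) \<Longrightarrow> y \<noteq> z \<Longrightarrow> mean_time P z x \<le> mean_time P z y"
    and child: "c \<in> set_pmf (P x) \<Longrightarrow> mean_time P z x + g \<le> mean_time P z c"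
  shows "1 + ennreal (pmf (P x) c) * g \<le> ennreal (pmf (P x) z) * mean_time P z x"
proof -
  define G where "G = mean_time P z"
  have "G x + ennreal (pmf (P x) c) * g = (\<integral>\<^sup>+y. G x + g * indicator {c} y \<partial>measure_pmf (P x))"
    by (simp add: nn_integral_add nn_integral_pmf_indicator_eq mult.commute)
  also have "\<dots> \<le> (\<integral>\<^sup>+y. G y + G x * indicator {z} y \<partial>measure_pmf (P x))"
  proof (rule nn_integral_pmf_mono)
    fix y assume "y \<in> set_pmf (P x)"
    then show "G x + g * indicator {c} y \<le> G y + G x * indicator {z} y"
      using assms unfolding G_def by (cases "y = z"; cases "y = c") auto
  qed
  also have "\<dots> = (\<integral>\<^sup>+y. G y \<partial>measure_pmf (P x)) + G x * ennreal (pmf (P x) z)"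
    by (simp add: nn_integral_add nn_integral_pmf_indicator_eq)
  finally have "1 + (G x + ennreal (pmf (P x) c) * g)
      \<le> 1 + ((\<integral>\<^sup>+y. G y \<partial>measure_pmf (P x)) + G x * ennreal (pmf (P x) z))"
    by (rule add_left_mono)
  then have "G x + (1 + ennreal (pmf (P x) c) * g) \<le> G x + ennreal (pmf (P x) z) * G x"
    using mean_time_first_step[OF \<open>x \<noteq> z\<close>, of P] by (simp add: G_def add_ac mult.commute)
  then show ?thesis using finite by (auto simp: G_def ennreal_add_left_cancel_le)
qed

text \<open>The second moment of the hitting time, since the square of n is the sum of the first n odd numbers.\<close>

definition second_moment :: "('v \<Rightarrow> 'v pmf) \<Rightarrow> 'v \<Rightarrow> 'v \<Rightarrow> ennreal" where
  "second_moment P z x = (\<Sum>t. ennreal (2 * real t + 1) * survive P z t x)"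

text \<open>The inequality (u - w)^2 \<le> c^2 in a form that avoids subtraction of extended nonnegative reals.\<close>

lemma square_increment:
  fixes u w c :: ennreal
  assumes "u \<le> w + c" "w \<le> u + c" "w < \<infinity>" "c < \<infinity>"
  shows "u\<^sup>2 + w\<^sup>2 \<le> 2 * w * u + c\<^sup>2"
proof -
  obtain w' where w: "w = ennreal w'" "w' \<ge> 0" using assms(3) by (cases w) auto
  obtain c' where c: "c = ennreal c'" "c' \<ge> 0" using assms(4) by (cases c) auto
  have "u < \<infinity>" using assms(1,3,4) by (auto simp: le_less_trans)
  then obtain u' where u: "u = ennreal u'" "u' \<ge> 0" by (cases u) auto
  have le: "u' \<le> w' + c'" "w' \<le> u' + c'"
    using assms(1,2) u w c by (simp_all flip: ennreal_plus)
  have "(u' - w')\<^sup>2 \<le> c'\<^sup>2" using le by (intro abs_le_square_iff[THEN iffD1]) auto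
  then have "u'\<^sup>2 + w'\<^sup>2 \<le> 2 * w' * u' + c'\<^sup>2" by (simp add: power2_eq_square algebra_simps)
  then have "ennreal (u'\<^sup>2 + w'\<^sup>2) \<le> ennreal (2 * w' * u' + c'\<^sup>2)" by (rule ennreal_leI)
  then show ?thesis
    using u w c by (simp add: ennreal_mult ennreal_power flip: ennreal_numeral)
qed

text \<open>If the mean hitting time changes by at most c in each step, then c^2 bounds the conditional variances of
the martingale made of the mean remaining time plus the elapsed time, so the variance of the hitting time
is at most c^2 times its mean. Analytically, U = G^2 + c^2 G is a supersolution of the first-step equation
of the second moment.\<close>

lemma second_moment_le:
  fixes c :: ennreal
  assumes closed: "\<And>x. x \<in> A \<Longrightarrow> set_pmf (P x) \<subseteq> insert z A"
    and incr: "\<And>x y. x \<in> A \<Longrightarrow> y \<in> set_pmf (P x) \<Longrightarrow>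
      mean_time P z y \<le> mean_time P z x + c \<and> mean_time P z x \<le> mean_time P z y + c"
    and finite: "\<And>x. x \<in> A \<Longrightarrow> mean_time P z x < \<infinity>" "c < \<infinity>"
    and "x \<in> A"
  shows "second_moment P z x \<le> (mean_time P z x)\<^sup>2 + c\<^sup>2 * mean_time P z x"
proof -
  define G where "G = mean_time P z"
  define U where "U x = (G x)\<^sup>2 + c\<^sup>2 * G x" for x
  define V where "V N x = (\<Sum>t<N. ennreal (2 * real t + 1) * survive P z t x)" for N x
  have super: "1 + (\<integral>\<^sup>+y. U y + 2 * G y \<partial>measure_pmf (P x)) \<le> U x" if "x \<in> A" "x \<noteq> z" for x
  proof -
    define I where "I = (\<integral>\<^sup>+y. G y \<partial>measure_pmf (P x))"
    define J where "J = (\<integral>\<^sup>+y. (G y)\<^sup>2 \<partial>measure_pmf (P x))"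
    have G: "G x = 1 + I" using that unfolding G_def I_def by (simp add: mean_time_first_step)
    have "J + (G x)\<^sup>2 = (\<integral>\<^sup>+y. (G y)\<^sup>2 + (G x)\<^sup>2 \<partial>measure_pmf (P x))"
      by (simp add: J_def nn_integral_pmf_add_const)
    also have "\<dots> \<le> (\<integral>\<^sup>+y. 2 * G x * G y + c\<^sup>2 \<partial>measure_pmf (P x))"
      using incr[OF that(1)] finite that unfolding G_def
      by (intro nn_integral_pmf_mono square_increment) auto
    also have "\<dots> = 2 * G x * I + c\<^sup>2"
      by (simp add: I_def nn_integral_pmf_add_const nn_integral_cmult)
    finally have "J + (G x)\<^sup>2 + 2 * G x \<le> 2 * G x * I + c\<^sup>2 + 2 * G x" by (rule add_right_mono)
    also have "\<dots> = (G x)\<^sup>2 + ((G x)\<^sup>2 + c\<^sup>2)"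
    proof -
      have "2 * G x * I + 2 * G x = 2 * G x * (1 + I)" by (simp add: distrib_left add_ac)
      also have "\<dots> = (G x)\<^sup>2 + (G x)\<^sup>2" by (simp flip: G add: power2_eq_square mult_2 distrib_right)
      finally show ?thesis by (simp add: add_ac)
    qed
    finally have "(G x)\<^sup>2 + (J + 2 * G x) \<le> (G x)\<^sup>2 + ((G x)\<^sup>2 + c\<^sup>2)" by (simp add: add_ac)
    then have *: "J + 2 * G x \<le> (G x)\<^sup>2 + c\<^sup>2"
      using finite(1)[OF that(1)] by (auto simp: ennreal_add_left_cancel_le G_def)
    have "1 + (\<integral>\<^sup>+y. U y + 2 * G y \<partial>measure_pmf (P x)) = 1 + (J + c\<^sup>2 * I + 2 * I)"
      by (simp add: U_def nn_integral_add nn_integral_cmult I_def J_def)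
    also have "\<dots> \<le> (J + 2 * G x) + c\<^sup>2 * I"
      unfolding G by (simp add: algebra_simps mult_2)
    also have "\<dots> \<le> ((G x)\<^sup>2 + c\<^sup>2) + c\<^sup>2 * I" by (intro add_right_mono *)
    also have "\<dots> = U x" unfolding U_def G by (simp add: algebra_simps)
    finally show ?thesis .
  qed
  have "V N x \<le> U x" if "x \<in> insert z A" for N x
    using that
  proof (induction N arbitrary: x)
    case (Suc N)
    show ?case
    proof (cases "x = z")
      case False
      then have "x \<in> A" using Suc.prems by simp
      have *: "ennreal (2 * real (Suc t) + 1) * survive P z (Suc t) x
          = (\<integral>\<^sup>+y. ennreal (2 * real t + 1) * survive P z t y + 2 * survive P z t y \<partial>measure_pmf (P x))" for t
      proof -
        have "ennreal (2 * real (Suc t) + 1) = ennreal (2 * real t + 1) + 2"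
          by (simp flip: ennreal_plus ennreal_numeral add: add_ac)
        then show ?thesis using False
          by (simp add: nn_integral_add nn_integral_cmult distrib_right del: of_nat_Suc)
      qed
      have "V (Suc N) x = 1 + (\<Sum>t<N. ennreal (2 * real (Suc t) + 1) * survive P z (Suc t) x)"
        using False unfolding V_def sum.lessThan_Suc_shift by simp
      also have "\<dots> = 1 + (\<integral>\<^sup>+y. V N y + 2 * (\<Sum>t<N. survive P z t y) \<partial>measure_pmf (P x))"
        unfolding * by (subst nn_integral_sum[symmetric]) (auto simp: V_def sum.distrib sum_distrib_left)
      also have "\<dots> \<le> 1 + (\<integral>\<^sup>+y. U y + 2 * G y \<partial>measure_pmf (P x))"
        using Suc.IH closed[OF \<open>x \<in> A\<close>] unfolding G_def mean_time_def
        by (intro add_left_mono nn_integral_pmf_mono add_mono mult_left_mono sum_le_suminf) auto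
      also have "\<dots> \<le> U x" by (rule super[OF \<open>x \<in> A\<close> False])
      finally show ?thesis .
    qed (simp add: V_def)
  qed (simp add: V_def)
  then have "(\<Sum>t. ennreal (2 * real t + 1) * survive P z t x) \<le> U x"
    using \<open>x \<in> A\<close> unfolding V_def by (intro suminf_le_const) auto
  then show ?thesis by (simp add: second_moment_def U_def G_def)
qed

text \<open>Let F(t) be the probability, started from \<pi>, of avoiding z up to time t. By stationarity F(t) is also
the probability of avoiding z during the times 1, ..., t + 1, so F(t) - F(t + 1) is the probability of
starting at z and avoiding z during these times. Read backwards, this is the sum over y of the flow
from y to z times the probability of avoiding z from y up to time t. Summing over t, F(0) bounds the mean
time from each neighbour y of z, weighted with the flow from y to z.\<close>

lemma reversible_mean_time:
  fixes \<pi> :: "'v \<Rightarrow> ennreal"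
  assumes reversible: "\<And>x y. \<pi> x * ennreal (pmf (P x) y) = \<pi> y * ennreal (pmf (P y) x)"
  shows "\<pi> y * ennreal (pmf (P y) z) * mean_time P z y \<le> (\<integral>\<^sup>+x. \<pi> x \<partial>count_space UNIV)"
proof -
  define F where "F t = (\<integral>\<^sup>+x. \<pi> x * survive P z t x \<partial>count_space UNIV)" for t
  define E where "E t = (\<integral>\<^sup>+x. \<pi> x * ennreal (pmf (P x) z) * survive P z t x \<partial>count_space UNIV)" for t
  \<comment> \<open>The loss E t is the missing term x = z in the sum for F (Suc t); reversibility then moves the step from x to y.\<close>
  have step: "F (Suc t) + E t = F t" for t
  proof -
    have "F (Suc t) + E t = (\<integral>\<^sup>+x. \<pi> x * survive P z (Suc t) x + E t * indicator {z} x \<partial>count_space UNIV)"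
      unfolding F_def by (subst nn_integral_add) (auto simp: nn_integral_cmult)
    also have "\<dots> = (\<integral>\<^sup>+x. (\<integral>\<^sup>+y. \<pi> y * ennreal (pmf (P y) x) * survive P z t y \<partial>count_space UNIV) \<partial>count_space UNIV)"
    proof (rule nn_integral_cong)
      fix x
      show "\<pi> x * survive P z (Suc t) x + E t * indicator {z} x
         = (\<integral>\<^sup>+y. \<pi> y * ennreal (pmf (P y) x) * survive P z t y \<partial>count_space UNIV)"
      proof (cases "x = z")
        case True
        then show ?thesis by (simp add: E_def)
      next
        case False
        have "\<pi> x * survive P z (Suc t) x
            = \<pi> x * (\<integral>\<^sup>+y. ennreal (pmf (P x) y) * survive P z t y \<partial>count_space UNIV)"
          using False by (simp add: nn_integral_measure_pmf)
        also have "\<dots> = (\<integral>\<^sup>+y. \<pi> x * ennreal (pmf (P x) y) * survive P z t y \<partial>count_space UNIV)"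
          by (simp add: nn_integral_cmult mult.assoc)
        finally show ?thesis using False by (simp add: reversible[of x])
      qed
    qed
    also have "\<dots> = (\<integral>\<^sup>+y. (\<integral>\<^sup>+x. \<pi> y * ennreal (pmf (P y) x) * survive P z t y \<partial>count_space UNIV) \<partial>count_space UNIV)"
      using nn_integral_snd_count_space[of "\<lambda>(x,y). \<pi> x * ennreal (pmf (P x) y) * survive P z t x"]
        nn_integral_fst_count_space[of "\<lambda>(x,y). \<pi> x * ennreal (pmf (P x) y) * survive P z t x"]
      by simp
    also have "\<dots> = F t"
      unfolding F_def
    proof (rule nn_integral_cong)
      fix y
      have "(\<integral>\<^sup>+x. \<pi> y * ennreal (pmf (P y) x) * survive P z t y \<partial>count_space UNIV)
        = (\<integral>\<^sup>+x. (\<pi> y * survive P z t y) * ennreal (pmf (P y) x) \<partial>count_space UNIV)"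
        by (simp add: mult_ac)
      also have "\<dots> = (\<pi> y * survive P z t y) * (\<integral>\<^sup>+x. 1 \<partial>measure_pmf (P y))"
        unfolding nn_integral_measure_pmf by (simp add: nn_integral_cmult)
      finally show "(\<integral>\<^sup>+x. \<pi> y * ennreal (pmf (P y) x) * survive P z t y \<partial>count_space UNIV)
        = \<pi> y * survive P z t y" by simp
    qed
    finally show ?thesis .
  qed
  have total: "F N + (\<Sum>t<N. E t) \<le> F 0" for N
  proof (induction N)
    case (Suc N)
    have "F (Suc N) + (\<Sum>t<Suc N. E t) = (F (Suc N) + E N) + (\<Sum>t<N. E t)" by (simp add: add_ac)
    also have "\<dots> = F N + (\<Sum>t<N. E t)" by (simp only: step)
    also note Suc
    finally show ?case .
  qed simp
  have "(\<Sum>t<N. E t) \<le> F 0" for N by (rule order_trans[OF _ total[of N]]) simp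
  then have *: "(\<Sum>t. E t) \<le> F 0" by (intro suminf_le_const) auto
  have "\<pi> y * ennreal (pmf (P y) z) * mean_time P z y
      = (\<Sum>t. \<pi> y * ennreal (pmf (P y) z) * survive P z t y)"
    by (simp add: mean_time_def)
  also have "\<dots> \<le> (\<Sum>t. E t)"
    unfolding E_def by (intro suminf_le nn_integral_ge_point) auto
  also note *
  also have "F 0 \<le> (\<integral>\<^sup>+x. \<pi> x \<partial>count_space UNIV)"
    unfolding F_def by (intro nn_integral_mono) auto
  finally show ?thesis .
qed

section \<open>Survival when the return to a reference state is fast\<close>

definition tail_time :: "('v \<Rightarrow> 'v pmf) \<Rightarrow> 'v \<Rightarrow> nat \<Rightarrow> 'v \<Rightarrow> ennreal" where
  "tail_time P z t x = (\<Sum>s. survive P z (s + t) x)"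

lemma tail_time_0 [simp]: "tail_time P z 0 x = mean_time P z x"
  by (simp add: tail_time_def mean_time_def)

lemma tail_time_target [simp]: "tail_time P z t z = 0"
  by (simp add: tail_time_def)

lemma tail_time_step: "tail_time P z t x = survive P z t x + tail_time P z (Suc t) x"
  unfolding tail_time_def by (subst suminf_Suc_ennreal) simp

lemma tail_time_Suc:
  assumes "x \<noteq> z"
  shows "tail_time P z (Suc t) x = (\<integral>\<^sup>+y. tail_time P z t y \<partial>measure_pmf (P x))"
  using assms by (simp add: tail_time_def nn_integral_suminf)

text \<open>Markov's inequality for the hitting time.\<close>

lemma survive_markov: "ennreal (real (Suc u)) * survive P z u x \<le> mean_time P z x"
proof -
  have "(\<Sum>t<Suc u. survive P z u x) \<le> (\<Sum>t<Suc u. survive P z t x)"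
    by (intro sum_mono survive_antimono) auto
  also have "\<dots> \<le> mean_time P z x"
    unfolding mean_time_def by (intro sum_le_suminf) auto
  finally show ?thesis by (simp add: ennreal_of_nat_eq_real_of_nat)
qed

text \<open>Given survival up to t, the mean remaining time is at most that of first going to r and then from
r to z. At t = 0 this is the supersolution bound, and the one-step recursion carries it along t.\<close>

lemma tail_time_le:
  assumes closed: "\<And>x. x \<in> A \<Longrightarrow> set_pmf (P x) \<subseteq> A"
    and return: "\<And>x. x \<in> A \<Longrightarrow> mean_time P r x \<le> R"
    and "x \<in> A"
  shows "tail_time P z t x \<le> (mean_time P z r + R) * survive P z t x"
  using \<open>x \<in> A\<close>
proof (induction t arbitrary: x)
  case 0
  have "mean_time P z x \<le> mean_time P r x + mean_time P z r" if "x \<in> A - {r}" for x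
  proof (rule mean_time_le_supersolution[where A = "A - {r}" and B = "{r}"])
    fix y assume "y \<in> A - {r}"
    then show "1 + (\<integral>\<^sup>+y. mean_time P r y + mean_time P z r \<partial>measure_pmf (P y))
        \<le> mean_time P r y + mean_time P z r"
      by (simp add: mean_time_first_step[of y r] nn_integral_add add_ac)
  qed (use closed that in auto)
  then have "mean_time P z x \<le> mean_time P r x + mean_time P z r"
    using 0 by (cases "x = r") auto
  then show ?case
    using return[OF 0] by (cases "x = z") (auto simp: add.commute intro: order_trans add_left_mono)
next
  case (Suc t)
  show ?case
  proof (cases "x = z")
    case False
    have "tail_time P z (Suc t) x \<le> (\<integral>\<^sup>+y. (mean_time P z r + R) * survive P z t y \<partial>measure_pmf (P x))"
      unfolding tail_time_Suc[OF False] using Suc closed by (intro nn_integral_pmf_mono) auto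
    then show ?thesis using False by (simp add: nn_integral_cmult)
  qed simp
qed

text \<open>A chain that survives for a further time u either has not met r during that time, with probability at
most b, or has met r before z, and then its mean remaining time is at least the mean time from r to z.\<close>

lemma survive_le_tail_time:
  assumes closed: "\<And>x. x \<in> A \<Longrightarrow> set_pmf (P x) \<subseteq> A"
    and return: "\<And>x. x \<in> A \<Longrightarrow> survive P r u x \<le> b"
    and "x \<in> A"
  shows "mean_time P z r * survive P z (t + u) x
    \<le> mean_time P z r * b * survive P z t x + tail_time P z t x"
  using \<open>x \<in> A\<close>
proof (induction t arbitrary: x)
  case 0
  let ?m = "mean_time P z r"
  \<comment> \<open>The case split on whether r is met within u, as an induction on u.\<close>
  have *: "?m * survive P z u x \<le> ?m * survive P r u x + mean_time P z x" for x
  proof (induction u arbitrary: x)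
    case 0
    show ?case by simp
  next
    case (Suc u)
    consider "x = z" | "x = r" | "x \<noteq> z" "x \<noteq> r" by blast
    then show ?case
    proof cases
      case 2
      show ?thesis using mult_left_mono[OF survive_le_one[of P z "Suc u" r], of ?m] 2
        by (simp del: survive.simps)
    next
      case 3
      have "?m * survive P z (Suc u) x = (\<integral>\<^sup>+y. ?m * survive P z u y \<partial>measure_pmf (P x))"
        using 3 by (simp add: nn_integral_cmult)
      also have "\<dots> \<le> (\<integral>\<^sup>+y. ?m * survive P r u y + mean_time P z y \<partial>measure_pmf (P x))"
        by (intro nn_integral_mono Suc)
      also have "\<dots> = ?m * survive P r (Suc u) x + (\<integral>\<^sup>+y. mean_time P z y \<partial>measure_pmf (P x))"
        using 3 by (simp add: nn_integral_cmult nn_integral_add)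
      also have "\<dots> \<le> ?m * survive P r (Suc u) x + mean_time P z x"
        using 3 by (intro add_left_mono) (simp add: mean_time_first_step[of x z])
      finally show ?thesis .
    qed simp
  qed
  show ?case
  proof (cases "x = z")
    case False
    have "?m * survive P z u x \<le> ?m * b + mean_time P z x"
      using return[OF 0] by (intro order_trans[OF *] add_mono mult_left_mono) auto
    then show ?thesis using False by simp
  qed simp
next
  case (Suc t)
  show ?case
  proof (cases "x = z")
    case False
    let ?m = "mean_time P z r"
    have "?m * survive P z (Suc t + u) x = (\<integral>\<^sup>+y. ?m * survive P z (t + u) y \<partial>measure_pmf (P x))"
      using False by (simp add: nn_integral_cmult)
    also have "\<dots> \<le> (\<integral>\<^sup>+y. ?m * b * survive P z t y + tail_time P z t y \<partial>measure_pmf (P x))"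
      using Suc closed by (intro nn_integral_pmf_mono) auto
    also have "\<dots> = ?m * b * survive P z (Suc t) x + tail_time P z (Suc t) x"
      using False by (simp add: nn_integral_cmult nn_integral_add tail_time_Suc)
    finally show ?thesis .
  qed simp
qed

text \<open>The two inequalities sandwich f between multiples of its tail sum I, so that I decays geometrically at a
rate between 1 / (m + R) and, up to the additive error u + m b, 1 / (m - 1).\<close>

lemma survival_bounds:
  fixes f I :: "nat \<Rightarrow> real"
  assumes step: "\<And>t. I t = f t + I (Suc t)" and I0: "I 0 = m" and f: "\<And>t. 0 \<le> f t" "\<And>t. f t \<le> 1"
    and I: "\<And>t. 0 \<le> I t"
    and upper: "\<And>t. I t \<le> (m + R) * f t" and lower: "\<And>t. m * f (t + u) \<le> m * b + I t"
    and pos: "m > 1" "R \<ge> 0" "b \<ge> 0"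
  shows "f t \<le> exp (- (real t - real u) / (m + R)) + b"
    and "f t \<ge> (m * exp (- real t / (m - 1)) - (real u + m * b)) / (m + R)"
proof -
  have up: "I t \<le> m * exp (- real t / (m + R))" for t
  proof (induction t)
    case 0
    then show ?case using I0 pos by simp
  next
    case (Suc t)
    have "I t / (m + R) \<le> f t" using upper[of t] pos by (simp add: field_simps)
    then have "I (Suc t) \<le> I t - I t / (m + R)" using step[of t] by linarith
    also have "\<dots> = I t * (1 - 1 / (m + R))" by (simp add: right_diff_distrib)
    also have "\<dots> \<le> I t * exp (- 1 / (m + R))"
      using exp_ge_add_one_self[of "- 1 / (m + R)"] I by (intro mult_left_mono) auto
    also have "\<dots> \<le> m * exp (- real t / (m + R)) * exp (- 1 / (m + R))"
      by (intro mult_right_mono Suc) auto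
    also have "\<dots> = m * exp (- real (Suc t) / (m + R))"
      by (simp add: mult_exp_exp add_divide_distrib diff_divide_distrib)
    finally show ?case .
  qed
  show "f t \<le> exp (- (real t - real u) / (m + R)) + b"
  proof (cases "u \<le> t")
    case True
    then have "m * f t \<le> m * b + I (t - u)" using lower[of "t - u"] by simp
    also have "\<dots> \<le> m * b + m * exp (- real (t - u) / (m + R))" using up by simp
    finally have "m * f t \<le> m * (exp (- real (t - u) / (m + R)) + b)" by (simp add: algebra_simps)
    then show ?thesis using \<open>m > 1\<close> True by (simp add: of_nat_diff)
  next
    case False
    then have "0 \<le> - (real t - real u) / (m + R)" using pos by (intro divide_nonneg_pos) auto
    then have "1 \<le> exp (- (real t - real u) / (m + R))" by (simp only: one_le_exp_iff)
    then show ?thesis using f(2)[of t] \<open>b \<ge> 0\<close> by linarith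
  qed
  \<comment> \<open>Adding this constant absorbs both the delay u in the lower hypothesis (as f \<le> 1) and the error b.\<close>
  define \<eta> where "\<eta> = real u + m * b"
  have early: "I t \<ge> m - real t" for t
  proof (induction t)
    case (Suc t)
    then show ?case using step[of t] f(2)[of t] by simp
  qed (use I0 pos in simp)
  have low: "I t + \<eta> \<ge> m * exp (- real t / (m - 1))" for t
  proof (induction t)
    case 0
    show ?case using I0 pos by (simp add: \<eta>_def)
  next
    case (Suc t)
    show ?case
    proof (cases "Suc t \<le> u")
      case True
      then have "m \<le> I (Suc t) + \<eta>" using early[of "Suc t"] pos
        unfolding \<eta>_def using True mult_nonneg_nonneg[of m b] by linarith
      moreover have "m * exp (- real (Suc t) / (m - 1)) \<le> m * 1"
        using I0 pos by (intro mult_left_mono) (auto simp: divide_nonpos_pos)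
      ultimately show ?thesis by linarith
    next
      case False
      then have ut: "u \<le> t" by simp
      have "m * f t \<le> m * b + I (t - u)" using lower[of "t - u"] ut by simp
      moreover have "I (t - k) \<le> I t + real k" if "k \<le> t" for k
        using that
      proof (induction k)
        case (Suc k)
        then have "I (t - Suc k) = f (t - Suc k) + I (t - k)"
          using step[of "t - Suc k"] by (simp add: Suc_diff_Suc)
        then show ?case using Suc f(2)[of "t - Suc k"] by simp
      qed simp
      ultimately have "m * f t \<le> I t + \<eta>" using ut by (fastforce simp: \<eta>_def)
      then have "f t \<le> (I t + \<eta>) / m" using \<open>m > 1\<close> by (simp add: field_simps)
      then have "(I t + \<eta>) - (I t + \<eta>) / m \<le> I (Suc t) + \<eta>" using step[of t] by linarith
      then have *: "(I t + \<eta>) * (1 - 1 / m) \<le> I (Suc t) + \<eta>" by (simp add: right_diff_distrib)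
      have "1 + 1 / (m - 1) \<le> exp (1 / (m - 1))" by (rule exp_ge_add_one_self)
      then have "exp (- 1 / (m - 1)) \<le> 1 - 1 / m"
        using \<open>m > 1\<close> by (simp add: exp_minus field_simps)
      then have "m * exp (- real t / (m - 1)) * exp (- 1 / (m - 1)) \<le> (I t + \<eta>) * (1 - 1 / m)"
        using Suc I[of t] pos by (intro mult_mono) (auto simp: \<eta>_def)
      with * have "m * exp (- real t / (m - 1)) * exp (- 1 / (m - 1)) \<le> I (Suc t) + \<eta>" by linarith
      moreover have "- real (Suc t) / (m - 1) = - real t / (m - 1) + - 1 / (m - 1)"
        by (simp add: add_divide_distrib diff_divide_distrib)
      ultimately show ?thesis by (simp only: exp_add mult.assoc)
    qed
  qed
  show "f t \<ge> (m * exp (- real t / (m - 1)) - (real u + m * b)) / (m + R)"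
    using low[of t] upper[of t] pos by (simp add: \<eta>_def field_simps)
qed

section \<open>Estimates for real sequences\<close>

text \<open>The two recursions give 1 + r(i+1)/w(i+1) \<ge> (1 + r(i)/w(i)) k/(k - 1) with k = death(i) w(i) \<le> K, and
k/(k - 1) \<ge> exp(1/K). In the chain, r(i)/w(i) is the invariant mass outside the branch at i divided by the
mass of that branch.\<close>

lemma reverse_drift_growth:
  fixes w r birth death :: "nat \<Rightarrow> real"
  assumes down: "\<And>i. 1 \<le> i \<Longrightarrow> i < n \<Longrightarrow> 1 + birth (Suc i) * w (Suc i) \<le> death i * w i"
    and up: "\<And>i. 1 \<le> i \<Longrightarrow> i < n \<Longrightarrow> 1 + death i * r i \<le> birth (Suc i) * r (Suc i)"
    and pos: "\<And>i. 1 \<le> i \<Longrightarrow> i \<le> n \<Longrightarrow> 0 < birth i \<and> 0 < death i \<and> 0 \<le> w i \<and> 0 \<le> r i"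
    and drift: "\<And>i. 1 \<le> i \<Longrightarrow> i \<le> n \<Longrightarrow> death i * w i \<le> K"
    and "1 \<le> K" "1 \<le> i" "i \<le> n"
  shows "(exp ((real i - 1) / K) - 1) * w i \<le> r i"
  using \<open>1 \<le> i\<close> \<open>i \<le> n\<close>
proof (induction i rule: nat_induct_at_least)
  case base
  then show ?case using pos[of 1] by simp
next
  case (Suc i)
  define E where "E = exp ((real i - 1) / K)"
  define e where "e = exp (1 / K)"
  define k where "k = death i * w i"
  have i: "1 \<le> i" "i < n" "i \<le> n" using Suc by auto
  have "1 \<le> E" using i \<open>1 \<le> K\<close> by (simp add: E_def)
  have "1 \<le> e" using \<open>1 \<le> K\<close> by (simp add: e_def)
  have k: "1 + birth (Suc i) * w (Suc i) \<le> k" "k \<le> K" "0 \<le> birth (Suc i) * w (Suc i)"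
    using down[OF i(1,2)] drift[OF i(1,3)] pos[of "Suc i"] i by (auto simp: k_def)
  have "k - 1 \<le> k * (1 - 1 / K)" using k(2) \<open>1 \<le> K\<close> by (simp add: field_simps)
  also have "\<dots> \<le> k * exp (- (1 / K))"
    using exp_ge_add_one_self[of "- (1 / K)"] k by (intro mult_left_mono) auto
  finally have "e * (k - 1) \<le> e * (k * exp (- (1 / K)))" by (intro mult_left_mono) (auto simp: e_def)
  also have "\<dots> = k" by (simp add: e_def exp_minus)
  finally have ek: "e * (k - 1) \<le> k" .
  have "(E * e - 1) * (birth (Suc i) * w (Suc i)) \<le> (E * e - 1) * (k - 1)"
    using k mult_mono[OF \<open>1 \<le> E\<close> \<open>1 \<le> e\<close>] by (intro mult_left_mono) (auto simp: E_def)
  also have "\<dots> = E * (e * (k - 1)) - (k - 1)" by (simp add: algebra_simps)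
  also have "\<dots> \<le> E * k - (k - 1)"
    using mult_left_mono[OF ek, of E] \<open>1 \<le> E\<close> by simp
  also have "\<dots> = 1 + death i * ((E - 1) * w i)" by (simp add: k_def algebra_simps)
  also have "\<dots> \<le> 1 + death i * r i"
    using Suc.IH i pos[of i] by (intro add_left_mono mult_left_mono) (auto simp: E_def)
  also have "\<dots> \<le> birth (Suc i) * r (Suc i)" by (rule up[OF i(1,2)])
  finally have "birth (Suc i) * ((E * e - 1) * w (Suc i)) \<le> birth (Suc i) * r (Suc i)"
    by (simp add: mult_ac)
  then have "(E * e - 1) * w (Suc i) \<le> r (Suc i)" using pos[of "Suc i"] i by simp
  also have "E * e = exp ((real (Suc i) - 1) / K)"
    by (simp add: E_def e_def mult_exp_exp flip: add_divide_distrib)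
  finally show ?case .
qed

text \<open>Indices up to about c K contribute at most (c + 1) K^2 / \<kappa> to the sum of w; beyond them r exceeds w by
the factor exp(c) - 1.\<close>

lemma reverse_drift_sum:
  fixes w r :: "nat \<Rightarrow> real"
  assumes growth: "\<And>i. 1 \<le> i \<Longrightarrow> i \<le> n \<Longrightarrow> (exp ((real i - 1) / K) - 1) * w i \<le> r i"
    and w: "\<And>i. 1 \<le> i \<Longrightarrow> i \<le> n \<Longrightarrow> 0 \<le> w i \<and> w i \<le> K / \<kappa>"
    and r: "\<And>i. 1 \<le> i \<Longrightarrow> i \<le> n \<Longrightarrow> 0 \<le> r i"
    and "1 \<le> K" "0 < \<kappa>" "0 \<le> c"
  shows "(exp c - 1) * ((\<Sum>i=1..n. w i) - (c + 1) * K\<^sup>2 / \<kappa>) \<le> (\<Sum>i=1..n. r i)"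
proof -
  define S where "S = {i \<in> {1..n}. real i - 1 < c * K}"
  have "S \<subseteq> {1..nat \<lceil>c * K\<rceil>}"
  proof
    fix i assume "i \<in> S"
    then show "i \<in> {1..nat \<lceil>c * K\<rceil>}" unfolding S_def by simp linarith
  qed
  then have "card S \<le> nat \<lceil>c * K\<rceil>" using card_mono[of "{1..nat \<lceil>c * K\<rceil>}" S] by simp
  then have "real (card S) \<le> c * K + 1" using \<open>0 \<le> c\<close> \<open>1 \<le> K\<close>
    by (smt (verit) mult_nonneg_nonneg of_nat_ceiling of_nat_le_iff real_nat_ceiling_ge ceiling_correct of_nat_nat zero_le_ceiling)
  also have "\<dots> \<le> (c + 1) * K" using \<open>1 \<le> K\<close> by (simp add: algebra_simps)
  finally have card: "real (card S) \<le> (c + 1) * K" .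
  have "(\<Sum>i\<in>S. w i) \<le> (\<Sum>i\<in>S. K / \<kappa>)" by (intro sum_mono) (use w in \<open>auto simp: S_def\<close>)
  also have "\<dots> = real (card S) * (K / \<kappa>)" by simp
  also have "\<dots> \<le> ((c + 1) * K) * (K / \<kappa>)"
    using card \<open>1 \<le> K\<close> \<open>0 < \<kappa>\<close> by (intro mult_right_mono) auto
  finally have S: "(\<Sum>i\<in>S. w i) \<le> (c + 1) * K\<^sup>2 / \<kappa>" by (simp add: power2_eq_square mult.assoc)
  have split: "(\<Sum>i=1..n. f i) = (\<Sum>i\<in>S. f i) + (\<Sum>i\<in>{1..n} - S. f i)" for f :: "nat \<Rightarrow> real"
    by (rule sum.subset_diff[THEN trans, OF _ _ add.commute]) (auto simp: S_def)
  have "(exp c - 1) * ((\<Sum>i=1..n. w i) - (c + 1) * K\<^sup>2 / \<kappa>) \<le> (exp c - 1) * (\<Sum>i\<in>{1..n} - S. w i)"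
    using S split[of w] \<open>0 \<le> c\<close> by (intro mult_left_mono) auto
  also have "\<dots> \<le> (\<Sum>i\<in>{1..n} - S. r i)"
    unfolding sum_distrib_left
  proof (rule sum_mono)
    fix i assume i: "i \<in> {1..n} - S"
    then have "c \<le> (real i - 1) / K" using \<open>1 \<le> K\<close> by (auto simp: S_def pos_le_divide_eq)
    then have "(exp c - 1) * w i \<le> (exp ((real i - 1) / K) - 1) * w i"
      using w[of i] i by (intro mult_right_mono) auto
    then show "(exp c - 1) * w i \<le> r i" using growth[of i] i by simp
  qed
  also have "\<dots> \<le> (\<Sum>i=1..n. r i)"
    unfolding split[of r] by (simp, intro sum_nonneg) (use r in \<open>auto simp: S_def\<close>)
  finally show ?thesis .
qed

lemma ratio_tendsto_0:
  fixes G m K :: "nat \<Rightarrow> real"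
  assumes drift: "(\<lambda>n. (K n)\<^sup>2 / G n) \<longlonglongrightarrow> 0"
    and G: "\<forall>\<^sub>F n in sequentially. 0 < G n"
    and bound: "\<And>c. 0 \<le> c \<Longrightarrow> \<forall>\<^sub>F n in sequentially. (exp c - 1) * (G n - (c + 1) * (K n)\<^sup>2 / \<kappa>) \<le> m n"
    and "0 < \<kappa>"
  shows "(\<lambda>n. G n / m n) \<longlonglongrightarrow> 0"
proof (rule LIMSEQ_I)
  fix \<epsilon> :: real assume "0 < \<epsilon>"
  \<comment> \<open>Half of G survives the subtraction below, so exp c - 1 = 4 / \<epsilon> leaves room for a strict bound.\<close>
  define c where "c = ln (1 + 4 / \<epsilon>)"
  have c: "0 \<le> c" "exp c - 1 = 4 / \<epsilon>" using \<open>0 < \<epsilon>\<close> by (auto simp: c_def add_pos_pos)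
  have "\<forall>\<^sub>F n in sequentially. (K n)\<^sup>2 / G n < \<kappa> / (2 * (c + 1))"
    using order_tendstoD(2)[OF drift] \<open>0 < \<kappa>\<close> c by simp
  with G bound[OF c(1)] have "\<forall>\<^sub>F n in sequentially. norm (G n / m n - 0) < \<epsilon>"
  proof eventually_elim
    case (elim n)
    have "(c + 1) * (K n)\<^sup>2 / \<kappa> \<le> G n / 2"
      using elim(1,3) \<open>0 < \<kappa>\<close> c by (simp add: field_simps)
    then have "(4 / \<epsilon>) * (G n / 2) \<le> (4 / \<epsilon>) * (G n - (c + 1) * (K n)\<^sup>2 / \<kappa>)"
      using \<open>0 < \<epsilon>\<close> by (intro mult_left_mono) auto
    then have m: "2 * G n / \<epsilon> \<le> m n" using elim(2) c by simp
    moreover have "0 < 2 * G n / \<epsilon>" using elim(1) \<open>0 < \<epsilon>\<close> by simp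
    ultimately have "0 < m n" by linarith
    moreover have "2 * G n \<le> \<epsilon> * m n" using m \<open>0 < \<epsilon>\<close> by (simp add: field_simps)
    ultimately show ?case using elim(1) by (simp add: field_simps)
  qed
  then show "\<exists>no. \<forall>n\<ge>no. norm (G n / m n - 0) < \<epsilon>" by (simp add: eventually_sequentially)
qed

text \<open>The delay u has to satisfy u = o(m) and R = o(u); the geometric mean of R and m does.\<close>

lemma survival_tendsto_exp:
  fixes f :: "nat \<Rightarrow> nat \<Rightarrow> real" and m R :: "nat \<Rightarrow> real"
  assumes m: "filterlim m at_top sequentially"
    and Rm: "(\<lambda>n. R n / m n) \<longlonglongrightarrow> 0" and R: "\<And>n. 0 \<le> R n"
    and upper: "\<forall>\<^sub>F n in sequentially. \<forall>t u. f n t \<le> exp (- (real t - real u) / (m n + R n)) + R n / real (Suc u)"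
    and lower: "\<forall>\<^sub>F n in sequentially. \<forall>t u.
      (m n * exp (- real t / (m n - 1)) - (real u + m n * (R n / real (Suc u)))) / (m n + R n) \<le> f n t"
    and "0 \<le> y"
  shows "(\<lambda>n. f n (nat \<lfloor>y * m n\<rfloor>)) \<longlonglongrightarrow> exp (- y)"
proof (rule tendsto_sandwich)
  define \<rho> where "\<rho> n = R n / m n" for n
  define \<delta> where "\<delta> n = 1 / m n" for n
  define s where "s n = sqrt (\<rho> n)" for n
  have \<rho>: "\<rho> \<longlonglongrightarrow> 0" using Rm by (simp add: \<rho>_def[abs_def])
  have \<delta>: "\<delta> \<longlonglongrightarrow> 0" unfolding \<delta>_def[abs_def] by (rule tendsto_divide_0[OF tendsto_const filterlim_at_top_imp_at_infinity[OF m]])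
  have s: "s \<longlonglongrightarrow> 0" using tendsto_real_sqrt[OF \<rho>] by (simp add: s_def[abs_def])
  define t where "t n = nat \<lfloor>y * m n\<rfloor>" for n
  define u where "u n = nat \<lceil>sqrt (R n * m n)\<rceil>" for n
  have big: "\<forall>\<^sub>F n in sequentially. 1 < m n" using m by (auto simp: filterlim_at_top_dense)
  have est: "real (t n) \<le> y * m n" "y * m n - 1 \<le> real (t n)" "real (u n) \<le> m n * s n + 1"
    "R n / real (Suc (u n)) \<le> s n" if "1 < m n" for n
  proof -
    have "0 \<le> y * m n" using that \<open>0 \<le> y\<close> by simp
    then show "real (t n) \<le> y * m n" "y * m n - 1 \<le> real (t n)" unfolding t_def by linarith+
    have root: "sqrt (R n * m n) = m n * s n"
    proof -
      have "R n * m n = (m n)\<^sup>2 * \<rho> n" using that by (simp add: \<rho>_def power2_eq_square)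
      then show ?thesis using that by (simp add: s_def real_sqrt_mult)
    qed
    have "0 \<le> sqrt (R n * m n)" using R that by simp
    then show "real (u n) \<le> m n * s n + 1" unfolding u_def root by linarith
    have "R n = (m n * s n) * s n" using that R[of n] by (simp add: s_def \<rho>_def mult.assoc)
    also have "\<dots> \<le> real (Suc (u n)) * s n"
    proof (rule mult_right_mono)
      have "m n * s n \<le> real (u n)" unfolding u_def root by (rule real_nat_ceiling_ge)
      then show "m n * s n \<le> real (Suc (u n))" by simp
    qed (use that R[of n] in \<open>simp add: s_def \<rho>_def\<close>)
    finally show "R n / real (Suc (u n)) \<le> s n" by (simp add: pos_divide_le_eq mult.commute del: of_nat_Suc)
  qed
  show "\<forall>\<^sub>F n in sequentially. (exp (- (y / (1 - \<delta> n))) - 2 * s n - \<delta> n) / (1 + \<rho> n) \<le> f n (nat \<lfloor>y * m n\<rfloor>)"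
    using big lower
  proof eventually_elim
    case (elim n)
    note e = est[OF elim(1)]
    have "0 \<le> \<rho> n" using elim R by (simp add: \<rho>_def)
    have "real (t n) / (m n - 1) \<le> y * m n / (m n - 1)"
      using e(1) elim by (intro divide_right_mono) auto
    also have "\<dots> = y / (1 - \<delta> n)" using elim by (simp add: \<delta>_def field_simps)
    finally have "exp (- (y / (1 - \<delta> n))) \<le> exp (- real (t n) / (m n - 1))" by simp
    then have "m n * exp (- (y / (1 - \<delta> n))) \<le> m n * exp (- real (t n) / (m n - 1))"
      using elim by (intro mult_left_mono) auto
    moreover have "m n * (R n / real (Suc (u n))) \<le> m n * s n" using e(4) elim by (intro mult_left_mono) auto
    moreover have "m n * \<delta> n = 1" using elim by (simp add: \<delta>_def)
    ultimately have "m n * (exp (- (y / (1 - \<delta> n))) - 2 * s n - \<delta> n)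
        \<le> m n * exp (- real (t n) / (m n - 1)) - (real (u n) + m n * (R n / real (Suc (u n))))"
      using e(3) unfolding right_diff_distrib by linarith
    then have "m n * (exp (- (y / (1 - \<delta> n))) - 2 * s n - \<delta> n) / (m n + R n)
        \<le> (m n * exp (- real (t n) / (m n - 1)) - (real (u n) + m n * (R n / real (Suc (u n))))) / (m n + R n)"
      using elim R[of n] by (intro divide_right_mono) auto
    also have "\<dots> \<le> f n (t n)" using elim(2) by blast
    also have "m n * (exp (- (y / (1 - \<delta> n))) - 2 * s n - \<delta> n) / (m n + R n)
        = (exp (- (y / (1 - \<delta> n))) - 2 * s n - \<delta> n) / (1 + \<rho> n)"
    proof -
      have "m n + R n = m n * (1 + \<rho> n)" using elim by (simp add: \<rho>_def distrib_left)
      then show ?thesis using elim by simp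
    qed
    finally show ?case unfolding t_def .
  qed
  show "\<forall>\<^sub>F n in sequentially. f n (nat \<lfloor>y * m n\<rfloor>) \<le> exp (- ((y - 2 * \<delta> n - s n) / (1 + \<rho> n))) + s n"
    using big upper
  proof eventually_elim
    case (elim n)
    note e = est[OF elim(1)]
    have m: "m n + R n = m n * (1 + \<rho> n)" using elim by (simp add: \<rho>_def distrib_left)
    have "m n * (y - 2 * \<delta> n - s n) \<le> real (t n) - real (u n)"
      using e(2,3) elim by (simp add: \<delta>_def right_diff_distrib mult.commute)
    then have "m n * (y - 2 * \<delta> n - s n) / (m n + R n) \<le> (real (t n) - real (u n)) / (m n + R n)"
      using elim R[of n] by (intro divide_right_mono) auto
    then have "(y - 2 * \<delta> n - s n) / (1 + \<rho> n) \<le> (real (t n) - real (u n)) / (m n + R n)"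
      using elim unfolding m by simp
    then have "exp (- (real (t n) - real (u n)) / (m n + R n)) \<le> exp (- ((y - 2 * \<delta> n - s n) / (1 + \<rho> n)))"
      by (simp only: exp_le_cancel_iff minus_divide_left[symmetric] neg_le_iff_le)
    moreover have "f n (t n) \<le> exp (- (real (t n) - real (u n)) / (m n + R n)) + R n / real (Suc (u n))"
      using elim(2) by blast
    ultimately show ?case using e(4) unfolding t_def by linarith
  qed
  have "(\<lambda>n. (exp (- (y / (1 - \<delta> n))) - 2 * s n - \<delta> n) / (1 + \<rho> n)) \<longlonglongrightarrow> (exp (- (y / (1 - 0))) - 2 * 0 - 0) / (1 + 0)"
    by (intro tendsto_intros s \<rho> \<delta>) auto
  then show "(\<lambda>n. (exp (- (y / (1 - \<delta> n))) - 2 * s n - \<delta> n) / (1 + \<rho> n)) \<longlonglongrightarrow> exp (- y)" by simp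
  have "(\<lambda>n. exp (- ((y - 2 * \<delta> n - s n) / (1 + \<rho> n))) + s n) \<longlonglongrightarrow> exp (- ((y - 2 * 0 - 0) / (1 + 0))) + 0"
    by (intro tendsto_intros s \<rho> \<delta>) auto
  then show "(\<lambda>n. exp (- ((y - 2 * \<delta> n - s n) / (1 + \<rho> n))) + s n) \<longlonglongrightarrow> exp (- y)" by simp
qed

lemma cdf_exponential:
  "cdf (density lborel (exponential_density 1)) y = (if y < 0 then 0 else 1 - exp (- y))"
proof -
  let ?E = "density lborel (exponential_density 1)"
  interpret prob_space ?E by (rule prob_space_exponential_density) simp
  have D: "distributed ?E lborel (\<lambda>x. x) (exponential_density 1)"
    by (simp add: distributed_def distr_id2 exponential_density_nonneg)
  show ?thesis
  proof (cases "y < 0")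
    case True
    have "emeasure ?E {..y} = (\<integral>\<^sup>+x. ennreal (exponential_density 1 x) * indicator {..y} x \<partial>lborel)"
      by (simp add: emeasure_density)
    also have "\<dots> = (\<integral>\<^sup>+(x::real). 0 \<partial>lborel)"
      using True by (intro nn_integral_cong) (auto simp: exponential_density_def split: split_indicator)
    finally show ?thesis using True by (simp add: cdf_def measure_def)
  next
    case False
    then show ?thesis using exponential_distributedD_le[OF D, of y] by (simp add: cdf_def atMost_def)
  qed
qed

section \<open>From a realisation to the kernel\<close>

text \<open>Countability of the state space lets an event be split according to the next position.\<close>

locale chain_realisation =
  fixes C :: "'v bd_chain" and x :: 'v and M :: "'w measure" and X :: "nat \<Rightarrow> 'w \<Rightarrow> 'v"
  assumes chain_from: "chain_from C x M X"
    and countable: "countable (verts C)"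
    and closed: "\<And>y. y \<in> verts C \<Longrightarrow> set_pmf (trans_pmf C y) \<subseteq> verts C"
begin

sublocale prob_space M
  using chain_from by (simp add: chain_from_def)

abbreviation P where "P \<equiv> trans_pmf C"

lemma X_in: "\<omega> \<in> space M \<Longrightarrow> X t \<omega> \<in> verts C"
  using chain_from measurable_space[of "X t" M "count_space (verts C)"] by (auto simp: chain_from_def)

lemma sets_X_eq [measurable]: "{\<omega> \<in> space M. X t \<omega> = y} \<in> sets M"
proof -
  have "X t -` (verts C \<inter> {y}) \<inter> space M \<in> sets M"
    using chain_from by (intro measurable_sets[of _ _ "count_space (verts C)"]) (auto simp: chain_from_def)
  also have "X t -` (verts C \<inter> {y}) \<inter> space M = {\<omega> \<in> space M. X t \<omega> = y}"
    using X_in by auto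
  finally show ?thesis .
qed

definition cylinder :: "(nat \<Rightarrow> 'v) \<Rightarrow> nat \<Rightarrow> 'w set" where
  "cylinder h t = {\<omega> \<in> space M. \<forall>s\<le>t. X s \<omega> = h s}"

text \<open>The window starts at t and not at 0 so that the induction below can condition on the history up to t.\<close>

definition avoid :: "'v \<Rightarrow> nat \<Rightarrow> nat \<Rightarrow> 'w set" where
  "avoid z t u = {\<omega> \<in> space M. \<forall>s\<in>{t..u}. X s \<omega> \<noteq> z}"

lemma sets_cylinder [measurable]: "cylinder h t \<in> sets M"
  unfolding cylinder_def by measurable

lemma sets_avoid [measurable]: "avoid z t u \<in> sets M"
  unfolding avoid_def by measurable

lemma cylinder_step:
  "emeasure M (cylinder (h(Suc t := y)) (Suc t)) = emeasure M (cylinder h t) * ennreal (pmf (P (h t)) y)"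
proof -
  have split: "cylinder (h(Suc t := y)) (Suc t) = {\<omega> \<in> space M. X (Suc t) \<omega> = y \<and> (\<forall>s\<le>t. X s \<omega> = h s)}"
    unfolding cylinder_def by (auto simp: le_Suc_eq)
  show ?thesis
  proof (cases "prob (cylinder h t) > 0")
    case True
    then have "cond_prob M (\<lambda>\<omega>. X (Suc t) \<omega> = y) (\<lambda>\<omega>. \<forall>s\<le>t. X s \<omega> = h s) = pmf (P (h t)) y"
      using chain_from unfolding chain_from_def cylinder_def by blast
    then have "prob (cylinder (h(Suc t := y)) (Suc t)) = pmf (P (h t)) y * prob (cylinder h t)"
      using True unfolding cond_prob_def split cylinder_def[of h t] by (simp add: field_simps)
    then show ?thesis by (simp add: emeasure_eq_measure ennreal_mult mult.commute)
  next
    case False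
    then have "emeasure M (cylinder h t) = 0"
      by (simp add: emeasure_eq_measure measure_le_0_iff not_less)
    moreover have "emeasure M (cylinder (h(Suc t := y)) (Suc t)) \<le> emeasure M (cylinder h t)"
      unfolding split by (rule emeasure_mono) (auto simp: cylinder_def[of h t] sets_cylinder[unfolded cylinder_def])
    ultimately show ?thesis by simp
  qed
qed

text \<open>The Markov property for all later times, obtained from the one-step property by splitting over the
position at time t + 1 and extending the history by it.\<close>

lemma emeasure_cylinder_avoid:
  "emeasure M (cylinder h t \<inter> avoid z t (t + r)) = emeasure M (cylinder h t) * survive P z r (h t)"
proof (induction r arbitrary: h t)
  case 0
  have "cylinder h t \<inter> avoid z t t = (if h t = z then {} else cylinder h t)"
    by (auto simp: cylinder_def avoid_def)
  then show ?case by simp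
next
  case (Suc r)
  consider "h t = z" | "h t \<notin> verts C" | "h t \<noteq> z" "h t \<in> verts C" by blast
  then show ?case
  proof cases
    case 1
    then have "cylinder h t \<inter> avoid z t (t + Suc r) = {}" by (auto simp: cylinder_def avoid_def)
    then show ?thesis using 1 by simp
  next
    case 2
    then have "cylinder h t = {}" unfolding cylinder_def using X_in[of _ t] by force
    then show ?thesis by simp
  next
    case 3
    define E where "E y = cylinder (h(Suc t := y)) (Suc t) \<inter> avoid z (Suc t) (Suc t + r)" for y
    have "cylinder h t \<inter> avoid z t (t + Suc r) = (\<Union>y\<in>verts C. E y)"
    proof (intro equalityI subsetI)
      fix \<omega> assume *: "\<omega> \<in> cylinder h t \<inter> avoid z t (t + Suc r)"
      then have "\<omega> \<in> E (X (Suc t) \<omega>)"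
        by (auto simp: E_def cylinder_def avoid_def le_Suc_eq)
      moreover have "X (Suc t) \<omega> \<in> verts C" using * X_in by (auto simp: cylinder_def)
      ultimately show "\<omega> \<in> (\<Union>y\<in>verts C. E y)" by blast
    next
      fix \<omega> assume "\<omega> \<in> (\<Union>y\<in>verts C. E y)"
      then obtain y where y: "\<omega> \<in> E y" by blast
      then have \<omega>: "\<omega> \<in> space M" "\<And>s. s \<le> t \<Longrightarrow> X s \<omega> = h s"
        by (auto simp: E_def cylinder_def le_Suc_eq)
      have "X s \<omega> \<noteq> z" if "s \<in> {t..t + Suc r}" for s
      proof (cases "s = t")
        case False
        then show ?thesis using y that by (auto simp: E_def avoid_def)
      qed (use 3 \<omega> in auto)
      then show "\<omega> \<in> cylinder h t \<inter> avoid z t (t + Suc r)"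
        using \<omega> by (auto simp: cylinder_def avoid_def)
    qed
    moreover have "X (Suc t) \<omega> = y" if "\<omega> \<in> E y" for \<omega> y
      using that by (auto simp: E_def cylinder_def)
    then have "disjoint_family_on E (verts C)" unfolding disjoint_family_on_def by blast
    moreover have "E y \<in> events" for y by (simp add: E_def)
    ultimately have "emeasure M (cylinder h t \<inter> avoid z t (t + Suc r)) = (\<integral>\<^sup>+y. emeasure M (E y) \<partial>count_space (verts C))"
      using countable by (simp add: emeasure_UN_countable)
    also have "\<dots> = (\<integral>\<^sup>+y. emeasure M (cylinder h t) * (ennreal (pmf (P (h t)) y) * survive P z r y) \<partial>count_space (verts C))"
      unfolding E_def Suc.IH cylinder_step by (simp add: mult.assoc)
    also have "\<dots> = (\<integral>\<^sup>+y. emeasure M (cylinder h t) * (ennreal (pmf (P (h t)) y) * survive P z r y) \<partial>count_space UNIV)"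
      using closed[OF 3(2)]
      by (auto simp: nn_integral_count_space_indicator pmf_eq_0_set_pmf intro!: nn_integral_cong split: split_indicator)
    also have "\<dots> = emeasure M (cylinder h t) * survive P z (Suc r) (h t)"
      using 3 by (simp add: nn_integral_cmult nn_integral_measure_pmf)
    finally show ?thesis .
  qed
qed

lemma AE_start: "AE \<omega> in M. X 0 \<omega> = x"
  using chain_from by (intro AE_I_eq_1) (auto simp: chain_from_def emeasure_eq_measure)

lemma emeasure_avoid: "emeasure M (avoid z 0 t) = survive P z t x"
proof -
  have "emeasure M (cylinder (\<lambda>_. x) 0) = 1"
    using chain_from by (simp add: chain_from_def emeasure_eq_measure cylinder_def)
  moreover have "emeasure M (avoid z 0 t) = emeasure M (cylinder (\<lambda>_. x) 0 \<inter> avoid z 0 (0 + t))"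
    using AE_start by (intro emeasure_eq_AE) (auto simp: avoid_def cylinder_def)
  ultimately show ?thesis using emeasure_cylinder_avoid[of "\<lambda>_. x" 0 z t] by simp
qed

end

lemma less_hitting_time_iff: "enat t < hitting_time X z \<omega> \<longleftrightarrow> (\<forall>s\<le>t. X s \<omega> \<noteq> z)"
proof -
  have "enat t < hitting_time X z \<omega> \<longleftrightarrow> enat (Suc t) \<le> hitting_time X z \<omega>"
    by (rule Suc_ile_eq[symmetric])
  also have "\<dots> \<longleftrightarrow> (\<forall>s. X s \<omega> = z \<longrightarrow> Suc t \<le> s)"
    unfolding hitting_time_def by (simp add: le_INF_iff)
  also have "\<dots> \<longleftrightarrow> (\<forall>s\<le>t. X s \<omega> \<noteq> z)"
    by (auto simp: not_less_eq_eq[symmetric])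
  finally show ?thesis .
qed

lemma suminf_one_ennreal: "(\<Sum>t. (1::ennreal)) = \<top>"
  by (simp add: suminf_eq_SUP ennreal_SUP_of_nat_eq_top)

lemma ennreal_of_enat_eq_suminf:
  "ennreal_of_enat h = (\<Sum>t. of_bool (enat t < h))"
proof (cases h)
  case (enat N)
  have "(\<Sum>t. of_bool (enat t < h) :: ennreal) = (\<Sum>t<N. of_bool (enat t < h))"
    using enat by (intro suminf_finite) auto
  then show ?thesis using enat by simp
qed (simp add: suminf_one_ennreal)

text \<open>This makes the square of a hitting time a sum of indicators of survival.\<close>

lemma ennreal_of_enat_square_eq_suminf:
  "(ennreal_of_enat h)\<^sup>2 = (\<Sum>t. ennreal (2 * real t + 1) * of_bool (enat t < h))"
proof (cases h)
  case (enat N)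
  have "(\<Sum>t. ennreal (2 * real t + 1) * of_bool (enat t < h))
      = (\<Sum>t<N. ennreal (2 * real t + 1) * of_bool (enat t < h))"
  proof (rule suminf_finite)
    fix t assume "t \<notin> {..<N}"
    then have "\<not> enat t < h" using enat by auto
    then show "ennreal (2 * real t + 1) * of_bool (enat t < h) = 0"
      by (simp only: of_bool_eq mult_zero_right)
  qed simp
  also have "\<dots> = (\<Sum>t<N. ennreal (2 * real t + 1))" using enat by simp
  also have "\<dots> = ennreal (\<Sum>t<N. 2 * real t + 1)" by (rule sum_ennreal) simp
  also have "(\<Sum>t<N. 2 * real t + 1) = (real N)\<^sup>2"
    by (induction N) (auto simp: power2_eq_square algebra_simps)
  also have "ennreal ((real N)\<^sup>2) = (ennreal (real N))\<^sup>2" by (rule ennreal_power[symmetric]) simp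
  also have "ennreal (real N) = ennreal_of_enat h" using enat by (simp add: ennreal_of_nat_eq_real_of_nat)
  finally show ?thesis by (rule sym)
next
  case infinity
  have "(\<Sum>t. (1::ennreal)) \<le> (\<Sum>t. ennreal (2 * real t + 1) * of_bool (enat t < h))"
  proof (intro suminf_le)
    fix t
    have "enat t < h" using infinity by simp
    moreover have "1 \<le> ennreal (2 * real t + 1)"
      using ennreal_leI[of 1 "2 * real t + 1"] by simp
    ultimately show "1 \<le> ennreal (2 * real t + 1) * of_bool (enat t < h)"
      by (simp only: of_bool_eq mult_1_right)
  qed auto
  then have "(\<Sum>t. ennreal (2 * real t + 1) * of_bool (enat t < h)) = \<top>"
    unfolding suminf_one_ennreal by (rule top_unique[THEN iffD1])
  moreover have "(ennreal_of_enat h)\<^sup>2 = \<top>" using infinity by simp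
  ultimately show ?thesis by (rule trans[OF _ sym, rotated])
qed

context chain_realisation
begin

lemma less_hitting_time: "\<omega> \<in> space M \<Longrightarrow> enat t < hitting_time X z \<omega> \<longleftrightarrow> \<omega> \<in> avoid z 0 t"
  by (auto simp: less_hitting_time_iff avoid_def)

abbreviation hit_time :: "'v \<Rightarrow> 'w \<Rightarrow> ennreal" where
  "hit_time z \<equiv> \<lambda>\<omega>. ennreal_of_enat (hitting_time X z \<omega>)"

lemma hit_time_eq:
  "\<omega> \<in> space M \<Longrightarrow> hit_time z \<omega> = (\<Sum>t. indicator (avoid z 0 t) \<omega>)"
  "\<omega> \<in> space M \<Longrightarrow> (hit_time z \<omega>)\<^sup>2 = (\<Sum>t. ennreal (2 * real t + 1) * indicator (avoid z 0 t) \<omega>)"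
  unfolding ennreal_of_enat_square_eq_suminf unfolding ennreal_of_enat_eq_suminf
  by (simp_all only: less_hitting_time indicator_def)

lemma hit_time_measurable: "hit_time z \<in> borel_measurable M"
  by (subst measurable_cong[OF hit_time_eq(1)]) auto

lemma mean_hit_time: "(\<integral>\<^sup>+\<omega>. hit_time z \<omega> \<partial>M) = mean_time P z x"
  by (simp add: hit_time_eq(1) nn_integral_suminf emeasure_avoid mean_time_def cong: nn_integral_cong)

lemma second_moment_hit_time: "(\<integral>\<^sup>+\<omega>. (hit_time z \<omega>)\<^sup>2 \<partial>M) = second_moment P z x"
  by (simp add: hit_time_eq(2) nn_integral_suminf nn_integral_cmult emeasure_avoid second_moment_def cong: nn_integral_cong)

lemma hit_time_gt:
  assumes "\<omega> \<in> space M"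
  shows "ennreal (real t) < hit_time z \<omega> \<longleftrightarrow> \<omega> \<in> avoid z 0 t"
proof -
  have "ennreal (real t) = ennreal_of_enat (enat t)" by (simp add: ennreal_of_nat_eq_real_of_nat)
  then have "ennreal (real t) < hit_time z \<omega> \<longleftrightarrow> enat t < hitting_time X z \<omega>"
    by (simp only: not_le[symmetric] ennreal_of_enat_le_iff)
  also note less_hitting_time[OF assms]
  finally show ?thesis .
qed

lemma hit_time_nat: "hit_time z \<omega> < \<infinity> \<Longrightarrow> \<exists>N. hit_time z \<omega> = ennreal (real N)"
  by (cases "hitting_time X z \<omega>") (auto simp: ennreal_of_nat_eq_real_of_nat)

text \<open>The conversion to a real number sends an infinite hitting time to 0, but a finite mean excludes that
value almost surely.\<close>

lemma cdf_scaled_hit_time: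
  assumes m: "mean_time P z x = ennreal m" "m > 0" and "y \<ge> 0"
  shows "prob {\<omega> \<in> space M. mean_scaled M (hit_time z) \<omega> \<le> y}
    = 1 - enn2real (survive P z (nat \<lfloor>y * m\<rfloor>) x)"
proof -
  define t where "t = nat \<lfloor>y * m\<rfloor>"
  have t: "real N \<le> y * m \<longleftrightarrow> N \<le> t" for N
    using assms by (simp add: t_def le_nat_iff le_floor_iff)
  have "AE \<omega> in M. hit_time z \<omega> \<noteq> \<infinity>"
    by (rule nn_integral_PInf_AE) (simp_all add: hit_time_measurable mean_hit_time m)
  then have "AE \<omega> in M. mean_scaled M (hit_time z) \<omega> \<le> y \<longleftrightarrow> \<omega> \<notin> avoid z 0 t"
  proof (rule AE_mp, intro AE_I2 impI)
    fix \<omega> assume \<omega>: "\<omega> \<in> space M" "hit_time z \<omega> \<noteq> \<infinity>"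
    then obtain N where N: "hit_time z \<omega> = ennreal (real N)" using hit_time_nat[of z \<omega>] by (auto simp: less_top)
    have "mean_scaled M (hit_time z) \<omega> = real N / m"
      using assms by (simp add: mean_scaled_def mean_hit_time N divide_ennreal)
    then have "mean_scaled M (hit_time z) \<omega> \<le> y \<longleftrightarrow> N \<le> t"
      using t[of N] \<open>m > 0\<close> by (simp add: divide_le_eq)
    also have "\<dots> \<longleftrightarrow> \<omega> \<notin> avoid z 0 t"
      using hit_time_gt[OF \<omega>(1), of t z] by (simp add: N ennreal_less_iff flip: not_less)
    finally show "mean_scaled M (hit_time z) \<omega> \<le> y \<longleftrightarrow> \<omega> \<notin> avoid z 0 t" .
  qed
  then have "prob {\<omega> \<in> space M. mean_scaled M (hit_time z) \<omega> \<le> y} = prob (space M - avoid z 0 t)"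
    unfolding mean_scaled_def using hit_time_measurable[of z] by (intro finite_measure_eq_AE) auto
  also have "\<dots> = 1 - prob (avoid z 0 t)" by (rule prob_compl) simp
  also have "prob (avoid z 0 t) = enn2real (survive P z t x)"
    by (simp add: measure_def emeasure_avoid)
  finally show ?thesis by (simp add: t_def)
qed

end

text \<open>Chebyshev's inequality for T divided by its mean. The square (Y - 1)^2 is never expanded with a minus
sign: the cross term 2Y is added on both sides before integrating.\<close>

lemma (in prob_space) mean_scaled_chebyshev:
  fixes T :: "'a \<Rightarrow> ennreal"
  assumes [measurable]: "T \<in> borel_measurable M"
    and mean: "(\<integral>\<^sup>+\<omega>. T \<omega> \<partial>M) = ennreal G" "G > 0"
    and second: "(\<integral>\<^sup>+\<omega>. (T \<omega>)\<^sup>2 \<partial>M) \<le> ennreal (G\<^sup>2 + s)" and "s \<ge> 0" "\<epsilon> > 0"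
  shows "prob {\<omega> \<in> space M. \<bar>mean_scaled M T \<omega> - 1\<bar> > \<epsilon>} \<le> s / (\<epsilon> * G)\<^sup>2"
proof -
  define Y where "Y = mean_scaled M T"
  have [measurable]: "Y \<in> borel_measurable M" unfolding Y_def mean_scaled_def by simp
  have "AE \<omega> in M. T \<omega> \<noteq> \<infinity>" by (rule nn_integral_PInf_AE) (auto simp: mean)
  then have T: "AE \<omega> in M. T \<omega> = ennreal (G * Y \<omega>)"
  proof (rule AE_mp, intro AE_I2 impI)
    fix \<omega> assume "T \<omega> \<noteq> \<infinity>"
    then obtain u where "T \<omega> = ennreal u" "u \<ge> 0" by (cases "T \<omega>") auto
    then show "T \<omega> = ennreal (G * Y \<omega>)"
      using mean(2) by (simp add: Y_def mean_scaled_def mean(1) divide_ennreal)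
  qed
  have Y0: "Y \<omega> \<ge> 0" for \<omega> by (simp add: Y_def mean_scaled_def)
  have "(\<integral>\<^sup>+\<omega>. ennreal (G\<^sup>2 * (Y \<omega> - 1)\<^sup>2) \<partial>M) + ennreal (2 * G\<^sup>2)
      = (\<integral>\<^sup>+\<omega>. ennreal (G\<^sup>2 * (Y \<omega> - 1)\<^sup>2) \<partial>M) + ennreal (2 * G) * (\<integral>\<^sup>+\<omega>. T \<omega> \<partial>M)"
    using mean(2) by (simp add: mean(1) power2_eq_square flip: ennreal_mult)
  also have "(\<integral>\<^sup>+\<omega>. T \<omega> \<partial>M) = (\<integral>\<^sup>+\<omega>. ennreal (G * Y \<omega>) \<partial>M)" by (rule nn_integral_cong_AE[OF T])
  also have "(\<integral>\<^sup>+\<omega>. ennreal (G\<^sup>2 * (Y \<omega> - 1)\<^sup>2) \<partial>M) + ennreal (2 * G) * \<dots>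
      = (\<integral>\<^sup>+\<omega>. ennreal (G\<^sup>2 * (Y \<omega> - 1)\<^sup>2) + ennreal (2 * G) * ennreal (G * Y \<omega>) \<partial>M)"
    by (simp add: nn_integral_add nn_integral_cmult)
  also have "\<dots> = (\<integral>\<^sup>+\<omega>. ennreal ((G * Y \<omega>)\<^sup>2) + ennreal (G\<^sup>2) \<partial>M)"
    using Y0 mean(2)
    by (intro nn_integral_cong) (simp flip: ennreal_mult ennreal_plus, simp add: power2_eq_square algebra_simps)
  also have "\<dots> = (\<integral>\<^sup>+\<omega>. (T \<omega>)\<^sup>2 + ennreal (G\<^sup>2) \<partial>M)"
    using T Y0 mean(2) by (intro nn_integral_cong_AE) (auto simp: ennreal_power elim!: eventually_mono)
  also have "\<dots> = (\<integral>\<^sup>+\<omega>. (T \<omega>)\<^sup>2 \<partial>M) + ennreal (G\<^sup>2)"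
    by (simp add: nn_integral_add emeasure_space_1)
  also have "\<dots> \<le> ennreal (G\<^sup>2 + s) + ennreal (G\<^sup>2)" by (intro add_right_mono second)
  also have "\<dots> = ennreal s + ennreal (2 * G\<^sup>2)" using \<open>s \<ge> 0\<close> by (simp flip: ennreal_plus)
  finally have var: "(\<integral>\<^sup>+\<omega>. ennreal (G\<^sup>2 * (Y \<omega> - 1)\<^sup>2) \<partial>M) \<le> ennreal s"
    by (simp add: ennreal_add_left_cancel_le add.commute[of _ "ennreal (2 * G\<^sup>2)"])
  let ?A = "{\<omega> \<in> space M. \<bar>Y \<omega> - 1\<bar> > \<epsilon>}"
  have "ennreal ((\<epsilon> * G)\<^sup>2) * emeasure M ?A = (\<integral>\<^sup>+\<omega>. ennreal ((\<epsilon> * G)\<^sup>2) * indicator ?A \<omega> \<partial>M)"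
    by (simp add: nn_integral_cmult)
  also have "\<dots> \<le> (\<integral>\<^sup>+\<omega>. ennreal (G\<^sup>2 * (Y \<omega> - 1)\<^sup>2) \<partial>M)"
  proof (intro nn_integral_mono)
    fix \<omega>
    have "\<epsilon>\<^sup>2 \<le> (Y \<omega> - 1)\<^sup>2" if "\<epsilon> < \<bar>Y \<omega> - 1\<bar>"
      using that \<open>\<epsilon> > 0\<close> by (intro abs_le_square_iff[THEN iffD1]) auto
    then show "ennreal ((\<epsilon> * G)\<^sup>2) * indicator ?A \<omega> \<le> ennreal (G\<^sup>2 * (Y \<omega> - 1)\<^sup>2)"
      by (auto simp: power_mult_distrib mult.commute mult_left_mono intro!: ennreal_leI split: split_indicator)
  qed
  also note var
  finally have "ennreal ((\<epsilon> * G)\<^sup>2 * prob ?A) \<le> ennreal s"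
    by (simp add: emeasure_eq_measure ennreal_mult)
  then have "(\<epsilon> * G)\<^sup>2 * prob ?A \<le> s" using \<open>s \<ge> 0\<close> by simp
  then show ?thesis
    using \<open>\<epsilon> > 0\<close> mean(2) by (simp add: Y_def pos_le_divide_eq mult.commute)
qed

section \<open>Rooted trees\<close>

lemma walk_Cons:
  "walk G (x # xs) \<longleftrightarrow> x \<in> verts G \<and> (xs = [] \<or> walk G xs \<and> {x, hd xs} \<in> edges G)"
  by (cases xs) (auto simp: walk_def)

lemma walk_appendD1: "walk G (xs @ ys) \<Longrightarrow> xs \<noteq> [] \<Longrightarrow> walk G xs"
  by (auto simp: walk_def successively_append_iff)

lemma walk_append:
  "walk G xs \<Longrightarrow> walk G ys \<Longrightarrow> {last xs, hd ys} \<in> edges G \<Longrightarrow> walk G (xs @ ys)"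
  by (auto simp: walk_def successively_append_iff)

lemma walk_rev: "walk G (rev xs) \<longleftrightarrow> walk G xs"
  by (simp add: walk_def insert_commute)

text \<open>Two different paths with the same ends agree up to some vertex x; from there on, follow the first one
until it meets the second one again and return along the second one to x. This is a cycle.\<close>

lemma acyclic_path_unique:
  assumes acyclic: "\<nexists>xs. graph_cycle G xs"
    and "path_between G x xs y" "path_between G x ys y"
  shows "xs = ys"
  using assms(2,3)
proof (induction xs arbitrary: x ys)
  case Nil
  then show ?case by (simp add: path_between_def walk_def)
next
  case (Cons x' xs)
  have x': "x' = x" using Cons.prems by (simp add: path_between_def)
  obtain ys' where ys: "ys = x # ys'"
    using Cons.prems(2) by (cases ys) (auto simp: path_between_def walk_def)
  show ?case
  proof (cases "xs = [] \<or> ys' = []")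
    case True
    have nil: "zs = [] \<longleftrightarrow> y = x" if "last (x # zs) = y" "x \<notin> set zs" for zs
      using that last_in_set[of zs] by (cases "zs = []") auto
    have "last (x # xs) = y" "x \<notin> set xs" "last (x # ys') = y" "x \<notin> set ys'"
      using Cons.prems by (simp_all add: path_between_def x' ys)
    then have "xs = [] \<longleftrightarrow> y = x" "ys' = [] \<longleftrightarrow> y = x" using nil by blast+
    then show ?thesis using True x' ys by simp
  next
    case False
    have P: "walk G xs" "distinct xs" "x \<notin> set xs" "{x, hd xs} \<in> edges G" "last xs = y" "x \<in> verts G"
      and Q: "walk G ys'" "distinct ys'" "x \<notin> set ys'" "{x, hd ys'} \<in> edges G" "last ys' = y"
      using Cons.prems x' ys False by (auto simp: path_between_def walk_Cons)
    show ?thesis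
    proof (cases "hd xs = hd ys'")
      case True
      then have "xs = ys'"
        using Cons.IH[of "hd xs" ys'] P Q by (simp add: path_between_def)
      then show ?thesis using x' ys by simp
    next
      case neq: False
      have "\<exists>z\<in>set xs. z \<in> set ys'" using P Q False by (metis last_in_set)
      then obtain xs1 z xs2 where xs: "xs = xs1 @ z # xs2" "z \<in> set ys'"
        and first: "\<forall>v\<in>set xs1. v \<notin> set ys'"
        using split_list_first_prop[of xs "\<lambda>z. z \<in> set ys'"] by blast
      obtain ys1 ys2 where ys': "ys' = ys1 @ z # ys2" using xs(2) by (meson split_list)
      let ?c = "(x # xs1 @ [z]) @ rev ys1"
      have "walk G (x # xs1 @ [z])"
        using walk_appendD1[of G "x # xs1 @ [z]" xs2] P xs by (simp add: walk_Cons)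
      moreover have "walk G (z # rev ys1)"
        using walk_appendD1[of G "ys1 @ [z]" ys2] Q ys' walk_rev[of G "ys1 @ [z]"] by simp
      then have "ys1 = [] \<or> walk G (rev ys1) \<and> {z, hd (rev ys1)} \<in> edges G"
        by (auto simp: walk_Cons)
      ultimately have "walk G ?c"
        using walk_append[of G "x # xs1 @ [z]" "rev ys1"] by auto
      moreover have "distinct ?c" using P Q xs ys' first by auto
      moreover have "3 \<le> length ?c" using neq xs ys' by (cases xs1; cases ys1) auto
      moreover have "last ?c = hd ys'" using ys' by (cases ys1) auto
      then have "{last ?c, hd ?c} \<in> edges G" using Q by (simp add: insert_commute)
      ultimately have "graph_cycle G ?c" unfolding graph_cycle_def by blast
      then show ?thesis using acyclic by blast
    qed
  qed
qed

locale tree =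
  fixes G :: "('v, 'm) rooted_graph_scheme"
  assumes tree: "rooted_tree G"
begin

abbreviation root where "root \<equiv> origin G"
abbreviation V where "V \<equiv> verts G"
abbreviation J where "J \<equiv> non_root G"

lemma root_in [simp]: "root \<in> V"
  using tree by (simp add: rooted_tree_def)

lemma acyclic: "\<nexists>xs. graph_cycle G xs"
  using tree by (simp add: rooted_tree_def)

lemma path_unique: "path_between G x xs y \<Longrightarrow> path_between G x ys y \<Longrightarrow> xs = ys"
  using acyclic by (rule acyclic_path_unique)

lemma root_pathI: "path_between G x xs root \<Longrightarrow> root_path G x = xs"
  unfolding root_path_def using path_unique by blast

lemma root_path:
  assumes "x \<in> V"
  shows "path_between G x (root_path G x) root"
proof -
  obtain xs where "path_between G x xs root"
    using assms tree root_in unfolding rooted_tree_def by blast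
  then show ?thesis using root_pathI by simp
qed

lemma root_path_root [simp]: "root_path G root = [root]"
  by (rule root_pathI) (simp add: path_between_def walk_def)

text \<open>The parent is the second vertex of the path to the root: a neighbour of x further along that path would
close a cycle. All structural facts about the tree follow from this recursion.\<close>

lemma root_path_parent:
  assumes "x \<in> J"
  shows "parent G x \<in> V" and "root_path G x = x # root_path G (parent G x)"
    and "x \<notin> set (root_path G (parent G x))"
proof -
  have x: "x \<in> V" "x \<noteq> root" using assms by (auto simp: non_root_def)
  from root_path[OF x(1)] obtain rs where rs: "root_path G x = x # rs"
    by (cases "root_path G x") (auto simp: path_between_def walk_def)
  have ne: "rs \<noteq> []" using root_path[OF x(1)] rs x(2) by (auto simp: path_between_def)
  have *: "walk G rs" "{x, hd rs} \<in> edges G" "distinct rs" "x \<notin> set rs" "last rs = root"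
    using root_path[OF x(1)] rs ne by (auto simp: path_between_def walk_Cons)
  have "parent G x = hd rs"
    unfolding parent_def tree_le_def rs
  proof (rule the_equality)
    show "{x, hd rs} \<in> edges G \<and> hd rs \<in> set (x # rs)" using * ne by simp
  next
    fix y assume y: "{x, y} \<in> edges G \<and> y \<in> set (x # rs)"
    then have "y \<noteq> x" using tree by (force simp: rooted_tree_def doubleton_eq_iff)
    then obtain rs1 rs2 where split: "rs = rs1 @ y # rs2" using y by (auto dest: split_list)
    show "y = hd rs"
    proof (rule ccontr)
      assume neq: "y \<noteq> hd rs"
      have "walk G (x # rs1 @ [y])"
        using walk_appendD1[of G "x # rs1 @ [y]" rs2] * split x by (simp add: walk_Cons)
      then have "graph_cycle G (x # rs1 @ [y])"
        using * split neq y by (cases rs1) (auto simp: graph_cycle_def insert_commute)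
      then show False using acyclic by blast
    qed
  qed
  moreover have "root_path G (hd rs) = rs"
    using * ne by (intro root_pathI) (simp add: path_between_def)
  moreover have "hd rs \<in> V" using * ne by (auto simp: walk_def)
  ultimately show "parent G x \<in> V" "root_path G x = x # root_path G (parent G x)"
    "x \<notin> set (root_path G (parent G x))"
    using rs * by auto
qed

lemma root_path_nonempty: "x \<in> V \<Longrightarrow> root_path G x \<noteq> []"
  using root_path[of x] by (auto simp: path_between_def walk_def)

lemma depth_root [simp]: "depth G root = 0"
  by (simp add: depth_def)

lemma depth_parent: "x \<in> J \<Longrightarrow> depth G x = Suc (depth G (parent G x))"
  using root_path_nonempty[of "parent G x"] by (simp add: depth_def root_path_parent Suc_diff_Suc)

lemma ell_root [simp]: "ell G root = {}"
  by (simp add: ell_def)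

lemma finite_ell [simp]: "finite (ell G x)"
  by (simp add: ell_def)

lemma ell_parent: "x \<in> J \<Longrightarrow> ell G x = insert x (ell G (parent G x))"
  by (simp add: ell_def depth_parent lessThan_Suc_eq_insert_0 image_image funpow_Suc_right del: funpow.simps(2))

lemma vertex_induct [consumes 1, case_names root child]:
  assumes "x \<in> V" "Q root" "\<And>x. x \<in> J \<Longrightarrow> Q (parent G x) \<Longrightarrow> Q x"
  shows "Q x"
  using \<open>x \<in> V\<close>
proof (induction "depth G x" arbitrary: x)
  case 0
  then have "x = root" using depth_parent[of x] by (auto simp: non_root_def)
  then show ?case using assms(2) by simp
next
  case (Suc d)
  then have "x \<in> J" by (auto simp: non_root_def)
  then show ?case using Suc depth_parent[of x] root_path_parent(1)[of x] assms(3) by simp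
qed

lemma ell_subset: "x \<in> V \<Longrightarrow> ell G x \<subseteq> set (root_path G x)"
  by (induction rule: vertex_induct) (auto simp: ell_parent root_path_parent(2))

lemma notin_ell_parent: "x \<in> J \<Longrightarrow> x \<notin> ell G (parent G x)"
  using ell_subset root_path_parent by blast

lemma branch_subset: "branch G x \<subseteq> V"
  by (auto simp: branch_def)

lemma branch_self: "x \<in> J \<Longrightarrow> x \<in> branch G x"
  by (auto simp: branch_def tree_le_def root_path_parent(2)[of x] non_root_def)

lemma root_notin_branch: "x \<in> J \<Longrightarrow> root \<notin> branch G x"
  by (auto simp: branch_def tree_le_def non_root_def)

lemma branch_non_root: "x \<in> J \<Longrightarrow> branch G x \<subseteq> J"
  using root_notin_branch branch_subset by (auto simp: non_root_def)

text \<open>The only edge between a branch and its complement joins the stem x to its parent.\<close>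

lemma parent_in_branch_iff:
  "y \<in> J \<Longrightarrow> y \<noteq> x \<Longrightarrow> parent G y \<in> branch G x \<longleftrightarrow> y \<in> branch G x"
  using root_path_parent[of y] by (auto simp: branch_def tree_le_def non_root_def)

lemma parent_notin_branch: "x \<in> J \<Longrightarrow> parent G x \<notin> branch G x"
  using root_path_parent(3) by (auto simp: branch_def tree_le_def)

end

section \<open>Birth and death chains on a tree\<close>

locale birth_death = tree C for C :: "'v bd_chain" +
  assumes birth_death: "birth_death_chain C"
begin

abbreviation P where "P \<equiv> trans_pmf C"

lemma birth_pos: "x \<in> J \<Longrightarrow> 0 < birth C x" and death_pos: "x \<in> J \<Longrightarrow> 0 < death C x"
  using birth_death by (auto simp: birth_death_chain_def)

lemma transitions:
  assumes "x \<in> V" "y \<in> set_pmf (P x)"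
  shows "y = x \<or> x \<in> J \<and> y = parent C x \<or> y \<in> J \<and> x = parent C y"
  using birth_death assms unfolding birth_death_chain_def set_pmf_iff by blast

lemma J_subset: "x \<in> J \<Longrightarrow> x \<in> V"
  by (simp add: non_root_def)

lemma closed: "x \<in> V \<Longrightarrow> set_pmf (P x) \<subseteq> V"
  using transitions root_path_parent(1) J_subset by blast

text \<open>The invariant measure, normalised to 1 at the root.\<close>

definition \<pi> :: "'v \<Rightarrow> real" where
  "\<pi> x = (if x \<in> V then \<Prod>y\<in>ell C x. birth C y / death C y else 0)"

lemma \<pi>_parent: "x \<in> J \<Longrightarrow> \<pi> x = birth C x / death C x * \<pi> (parent C x)"
  by (simp add: \<pi>_def J_subset root_path_parent(1) ell_parent notin_ell_parent)

lemma \<pi>_pos: "x \<in> V \<Longrightarrow> 0 < \<pi> x"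
proof (induction rule: vertex_induct)
  case root
  then show ?case by (simp add: \<pi>_def)
next
  case (child x)
  then show ?case by (simp add: \<pi>_parent birth_pos death_pos)
qed

lemma \<pi>_nonneg: "0 \<le> \<pi> x"
  using \<pi>_pos[of x] by (cases "x \<in> V") (auto simp: \<pi>_def)

lemma parent_balance:
  assumes "x \<in> J"
  shows "\<pi> x * pmf (P x) (parent C x) = \<pi> (parent C x) * pmf (P (parent C x)) x"
  using \<pi>_parent[OF assms] death_pos[OF assms] by (simp add: birth_def death_def)

lemma reversible: "\<pi> x * pmf (P x) y = \<pi> y * pmf (P y) x"
proof -
  have "\<pi> x * pmf (P x) y = \<pi> y * pmf (P y) x" if "y \<in> set_pmf (P x)" "x \<in> V" for x y
    using transitions[OF that(2,1)] parent_balance by auto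
  moreover have "\<pi> x * pmf (P x) y = 0" if "\<not> (y \<in> set_pmf (P x) \<and> x \<in> V)" for x y
    using that by (auto simp: \<pi>_def set_pmf_iff)
  ultimately show ?thesis by metis
qed

lemma summable_\<pi>: "\<pi> summable_on V"
proof (cases "finite V")
  case False
  then have "(\<lambda>x. \<Prod>y\<in>ell C x. birth C y / death C y) summable_on V"
    using birth_death by (simp add: birth_death_chain_def)
  then show ?thesis by (rule summable_on_cong[THEN iffD1, rotated]) (simp add: \<pi>_def)
qed simp

lemma countable_V: "countable V"
proof -
  have "{x \<in> V. \<pi> x \<noteq> 0} = V" using \<pi>_pos by fastforce
  then show ?thesis using summable_countable_real[OF summable_\<pi>] by simp
qed

lemma \<pi>_total: "(\<integral>\<^sup>+x. ennreal (\<pi> x) \<partial>count_space UNIV) < \<infinity>"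
proof -
  have "Infinite_Set_Sum.abs_summable_on \<pi> V"
    using summable_\<pi> summable_on_iff_abs_summable_on_real abs_summable_equivalent by blast
  then have "(\<integral>\<^sup>+x. ennreal (norm (\<pi> x)) \<partial>count_space V) < \<infinity>"
    by (simp add: Infinite_Set_Sum.abs_summable_on_def integrable_iff_bounded)
  also have "(\<integral>\<^sup>+x. ennreal (norm (\<pi> x)) \<partial>count_space V) = (\<integral>\<^sup>+x. ennreal (\<pi> x) \<partial>count_space UNIV)"
    by (auto simp: nn_integral_count_space_indicator \<pi>_def[abs_def] \<pi>_nonneg[unfolded \<pi>_def] intro!: nn_integral_cong split: split_indicator)
  finally show ?thesis .
qed

text \<open>This is where the summability condition on the chain is used.\<close>

lemma mean_time_neighbour_finite:
  assumes "x \<in> V" "pmf (P x) z > 0"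
  shows "mean_time P z x < \<infinity>"
proof -
  have "ennreal (\<pi> x) * ennreal (pmf (P x) z) * mean_time P z x \<le> (\<integral>\<^sup>+x. ennreal (\<pi> x) \<partial>count_space UNIV)"
    by (rule reversible_mean_time) (simp add: reversible \<pi>_nonneg flip: ennreal_mult)
  then have "ennreal (\<pi> x * pmf (P x) z) * mean_time P z x < \<infinity>"
    using \<pi>_total by (simp add: \<pi>_nonneg ennreal_mult le_less_trans)
  then show ?thesis
    using \<pi>_pos[OF assms(1)] assms(2) by (auto simp: ennreal_mult_less_top)
qed

text \<open>Every vertex separates the tree. This and the next lemma make mean hitting times additive along the
paths of the tree, in both directions.\<close>

lemma gate_branch:
  assumes "x \<in> J"
  shows "gate P (branch C x) (parent C x)"
  unfolding gate_def
proof (intro conjI ballI subsetI)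
  fix y z assume y: "y \<in> branch C x" and "z \<in> set_pmf (P y)"
  moreover have "y \<in> V" using y branch_subset by blast
  ultimately consider "z = y" | "y \<in> J" "z = parent C y" | "z \<in> J" "y = parent C z"
    using transitions by blast
  then show "z \<in> insert (parent C x) (branch C x)"
  proof cases
    case 2
    then show ?thesis using parent_in_branch_iff[of y x] y by (cases "y = x") auto
  next
    case 3
    then show ?thesis using parent_in_branch_iff[of z x] y parent_notin_branch[OF assms] by (cases "z = x") auto
  qed (use y in simp)
qed (rule parent_notin_branch[OF assms])

lemma gate_complement:
  assumes "x \<in> J"
  shows "gate P (V - branch C x) x"
  unfolding gate_def
proof (intro conjI ballI subsetI)
  fix y z assume y: "y \<in> V - branch C x" and z: "z \<in> set_pmf (P y)"
  then have "z \<in> V" using closed by blast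
  consider "z = y" | "y \<in> J" "z = parent C y" | "z \<in> J" "y = parent C z"
    using transitions y z by blast
  then have "z \<notin> branch C x \<or> z = x"
  proof cases
    case 2
    then show ?thesis using parent_in_branch_iff[of y x] y branch_self[OF assms] by (cases "y = x") auto
  next
    case 3
    then show ?thesis using parent_in_branch_iff[of z x] y by (cases "z = x") auto
  qed (use y in simp)
  then show "z \<in> insert x (V - branch C x)" using \<open>z \<in> V\<close> by blast
qed (use branch_self[OF assms] in simp)

lemma mean_time_from_branch:
  assumes "x \<in> J" "y \<in> branch C x" "z \<notin> branch C x"
  shows "mean_time P z y = mean_time P (parent C x) y + mean_time P z (parent C x)"
  using mean_time_gate[OF gate_branch[OF assms(1)] assms(3,2)] .

lemma mean_time_into_branch:
  assumes "x \<in> J" "y \<in> V - branch C x" "z \<in> branch C x"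
  shows "mean_time P z y = mean_time P x y + mean_time P z x"
  using mean_time_gate[OF gate_complement[OF assms(1)] _ assms(2)] assms(3) by simp

abbreviation descent where "descent x \<equiv> mean_time P (parent C x) x"
abbreviation ascent where "ascent x \<equiv> mean_time P x (parent C x)"

lemma descent_finite: "x \<in> J \<Longrightarrow> descent x < \<infinity>"
  using mean_time_neighbour_finite[of x "parent C x"] death_pos[of x] by (simp add: J_subset death_def)

lemma ascent_finite: "x \<in> J \<Longrightarrow> ascent x < \<infinity>"
  using mean_time_neighbour_finite[of "parent C x" x] birth_pos[of x] by (simp add: root_path_parent(1) birth_def)

lemma parent_neq: "x \<in> J \<Longrightarrow> parent C x \<noteq> x"
  using parent_notin_branch[of x] branch_self[of x] by auto

lemma grandparent_notin_branch:
  assumes "y \<in> J" "parent C y \<in> J"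
  shows "parent C (parent C y) \<notin> branch C y"
proof
  assume "parent C (parent C y) \<in> branch C y"
  then have "parent C y \<in> branch C y"
    using parent_in_branch_iff[of "parent C y" y] assms parent_neq[of y] by auto
  then show False using parent_notin_branch[OF assms(1)] by simp
qed

lemma sibling_notin_branch:
  assumes "x \<in> J" "y \<in> J" "x \<noteq> y" "parent C x = parent C y"
  shows "x \<notin> branch C y"
  using parent_in_branch_iff[of x y] parent_notin_branch[of y] assms by auto

lemma descent_le_child:
  assumes "x \<in> J" "y \<in> set_pmf (P x)" "y \<noteq> parent C x"
  shows "descent x \<le> mean_time P (parent C x) y"
proof -
  consider "y = x" | "y \<in> J" "x = parent C y" using transitions J_subset assms by blast
  then show ?thesis
  proof cases
    case 2
    then have "mean_time P (parent C x) y = descent y + descent x"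
      using mean_time_from_branch[of y y "parent C x"] branch_self grandparent_notin_branch assms by auto
    then show ?thesis by simp
  qed simp
qed

lemma one_le_death_descent:
  assumes "x \<in> J"
  shows "1 \<le> ennreal (death C x) * descent x"
  using drift_recursion[of x "parent C x" x P 0] parent_neq[OF assms] descent_finite[OF assms]
    descent_le_child[OF assms] by (simp add: death_def)

text \<open>In the first-step equation at the parent of y only the excursion into the branch at y is kept; the other
children can only increase the time.\<close>

lemma descent_recursion:
  assumes "y \<in> J" "parent C y \<in> J"
  shows "1 + ennreal (birth C y) * descent y \<le> ennreal (death C (parent C y)) * descent (parent C y)"
  unfolding birth_def death_def
proof (rule drift_recursion)
  let ?x = "parent C y"
  show "?x \<noteq> parent C ?x" using parent_neq[OF assms(2)] by simp
  show "y \<noteq> parent C ?x"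
    using grandparent_notin_branch[OF assms] branch_self[OF assms(1)] by auto
  show "descent ?x < \<infinity>" by (rule descent_finite[OF assms(2)])
  show "descent ?x + descent y \<le> mean_time P (parent C ?x) y"
    using mean_time_from_branch[of y y "parent C ?x"] branch_self grandparent_notin_branch assms
    by (simp add: add.commute)
qed (rule descent_le_child[OF assms(2)])

text \<open>From the parent of y, stepping one level up costs an additional ascent to the parent; stepping into
another branch at the parent means having to come back first.\<close>

lemma ascent_recursion:
  assumes "y \<in> J" "parent C y \<in> J"
  shows "1 + ennreal (death C (parent C y)) * ascent (parent C y) \<le> ennreal (birth C y) * ascent y"
  unfolding birth_def death_def
proof (rule drift_recursion)
  let ?x = "parent C y"
  have up: "mean_time P y (parent C ?x) = ascent ?x + ascent y"
  proof (rule mean_time_into_branch[OF assms(2)])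
    show "parent C ?x \<in> V - branch C ?x"
      using parent_notin_branch root_path_parent(1) assms by auto
    show "y \<in> branch C ?x"
      using parent_in_branch_iff[of y ?x] branch_self[of ?x] parent_neq[of y, THEN not_sym] assms by simp
  qed
  show "?x \<noteq> y" using parent_neq[OF assms(1)] .
  show "parent C ?x \<noteq> y"
    using grandparent_notin_branch[OF assms] branch_self[OF assms(1)] by auto
  show "ascent y < \<infinity>" by (rule ascent_finite[OF assms(1)])
  show "ascent y + ascent ?x \<le> mean_time P y (parent C ?x)" using up by (simp add: add.commute)
  fix z assume z: "z \<in> set_pmf (P ?x)" "z \<noteq> y"
  consider "z = ?x" | "z = parent C ?x" | "z \<in> J" "parent C z = ?x"
    using transitions[OF _ z(1)] J_subset assms by fastforce
  then show "ascent y \<le> mean_time P y z"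
  proof cases
    case 2
    then show ?thesis using up by simp
  next
    case 3
    then have "mean_time P y z = mean_time P ?x z + ascent y"
      using mean_time_from_branch[of z z y] branch_self sibling_notin_branch[of y z] z(2) assms by auto
    then show ?thesis by simp
  qed simp
qed

end

section \<open>One chain along the path\<close>

locale birth_death_path = birth_death C for C :: "'v bd_chain" +
  fixes v :: "nat \<Rightarrow> 'v" and n :: nat
  assumes v_0: "v 0 = origin C"
    and v_in: "k \<le> n \<Longrightarrow> v k \<in> verts C"
    and v_parent: "1 \<le> k \<Longrightarrow> k \<le> n \<Longrightarrow> parent C (v k) = v (k - 1)"
    and v_inj: "inj v"
    and n_pos: "1 \<le> n"
begin

lemma v_J: "1 \<le> k \<Longrightarrow> k \<le> n \<Longrightarrow> v k \<in> J"
  using v_in[of k] v_0 injD[OF v_inj, of k 0] by (auto simp: non_root_def)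

lemma v_Suc_parent: "Suc k \<le> n \<Longrightarrow> parent C (v (Suc k)) = v k"
  using v_parent[of "Suc k"] by simp

lemma depth_v: "k \<le> n \<Longrightarrow> depth C (v k) = k"
proof (induction k)
  case (Suc k)
  then show ?case using depth_parent[OF v_J[of "Suc k"]] by (simp add: v_Suc_parent)
qed (simp add: v_0)

lemma alpha_v: "alpha C (v n) = v 1"
proof -
  have "j < n \<Longrightarrow> (parent C ^^ j) (v n) = v (n - j)" for j
  proof (induction j)
    case (Suc j)
    then show ?case using v_parent[of "n - j"] by simp
  qed simp
  from this[of "n - 1"] show ?thesis using n_pos by (simp add: alpha_def depth_v)
qed

lemma v_branch: "1 \<le> i \<Longrightarrow> i \<le> j \<Longrightarrow> j \<le> n \<Longrightarrow> v j \<in> branch C (v i)"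
proof (induction j)
  case (Suc j)
  show ?case
  proof (cases "i = Suc j")
    case True
    then show ?thesis using Suc.prems by (simp add: branch_self v_J)
  next
    case False
    then have "v (Suc j) \<in> J" "v (Suc j) \<noteq> v i" using Suc.prems v_J injD[OF v_inj, of "Suc j" i] by auto
    then show ?thesis using parent_in_branch_iff[of "v (Suc j)" "v i"] Suc False by (simp add: v_Suc_parent)
  qed
qed simp

lemma sum_descent: "k \<le> n \<Longrightarrow> mean_time P (v 0) (v k) = (\<Sum>i=1..k. descent (v i))"
proof (induction k)
  case (Suc k)
  then have "v (Suc k) \<in> J" by (intro v_J) auto
  then have "mean_time P (v 0) (v (Suc k)) = descent (v (Suc k)) + mean_time P (v 0) (v k)"
    using mean_time_from_branch[of "v (Suc k)" "v (Suc k)" "v 0"] branch_self root_notin_branch Suc.prems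
    by (simp add: v_0 v_Suc_parent)
  then show ?case using Suc by (simp add: add.commute)
qed simp

lemma sum_ascent: "k \<le> n \<Longrightarrow> mean_time P (v n) (v 0) = (\<Sum>i=1..k. ascent (v i)) + mean_time P (v n) (v k)"
proof (induction k)
  case (Suc k)
  then have "v (Suc k) \<in> J" by (intro v_J) auto
  then have "mean_time P (v n) (v k) = ascent (v (Suc k)) + mean_time P (v n) (v (Suc k))"
    using mean_time_into_branch[of "v (Suc k)" "v k" "v n"] parent_notin_branch[of "v (Suc k)"]
      v_branch[of "Suc k" n] v_in[of k] Suc.prems
    by (simp add: v_Suc_parent)
  then show ?case using Suc by (simp add: add.assoc)
qed simp

abbreviation G where "G \<equiv> enn2real (mean_time P (v 0) (v n))"
abbreviation m where "m \<equiv> enn2real (mean_time P (v n) (v 0))"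

lemma G_eq: "G = (\<Sum>i=1..n. enn2real (descent (v i)))" and G_finite: "mean_time P (v 0) (v n) < \<infinity>"
  and m_eq: "m = (\<Sum>i=1..n. enn2real (ascent (v i)))" and m_finite: "mean_time P (v n) (v 0) < \<infinity>"
proof -
  have fin: "descent (v i) < \<infinity>" "ascent (v i) < \<infinity>" if "i \<in> {1..n}" for i
    using that by (auto intro!: v_J descent_finite[unfolded infinity_ennreal_def] ascent_finite[unfolded infinity_ennreal_def])
  show "mean_time P (v 0) (v n) < \<infinity>" "mean_time P (v n) (v 0) < \<infinity>"
    using fin by (auto simp: sum_descent sum_ascent[of n])
  show "G = (\<Sum>i=1..n. enn2real (descent (v i)))"
    unfolding sum_descent[OF order_refl] by (rule enn2real_sum[unfolded comp_def]) (use fin in auto)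
  have "mean_time P (v n) (v 0) = (\<Sum>i=1..n. ascent (v i))" by (simp add: sum_ascent[of n])
  then show "m = (\<Sum>i=1..n. enn2real (ascent (v i)))"
    using fin by (simp only: enn2real_sum[unfolded comp_def] infinity_ennreal_def)
qed

lemma G_ge_1: "1 \<le> G" and m_ge_n: "real n \<le> m"
proof -
  show "1 \<le> G"
    using one_le_mean_time[of "v n" "v 0" P] G_finite injD[OF v_inj, of n 0] n_pos
      enn2real_mono[of 1 "mean_time P (v 0) (v n)"] by auto
  have "1 \<le> enn2real (ascent (v i))" if "1 \<le> i" "i \<le> n" for i
    using one_le_mean_time[of "parent C (v i)" "v i" P] parent_neq[OF v_J[OF that]]
      ascent_finite[OF v_J[OF that]] enn2real_mono[of 1 "ascent (v i)"] by auto
  then have "(\<Sum>i=1..n. 1) \<le> (\<Sum>i=1..n. enn2real (ascent (v i)))" by (intro sum_mono) auto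
  then show "real n \<le> m" by (simp add: m_eq)
qed

text \<open>The analytic bounds on the survival function, applied to the escape from the root to the end of the
path; the probability of not having returned to the root within u is controlled by Markov's inequality.\<close>

lemma survival_estimates:
  assumes return: "\<And>x. x \<in> V \<Longrightarrow> mean_time P (v 0) x \<le> ennreal R" and "0 \<le> R" "1 < m"
  shows "enn2real (survive P (v n) t (v 0)) \<le> exp (- (real t - real u) / (m + R)) + R / real (Suc u)"
    and "(m * exp (- real t / (m - 1)) - (real u + m * (R / real (Suc u)))) / (m + R)
      \<le> enn2real (survive P (v n) t (v 0))"
proof -
  define f where "f t = enn2real (survive P (v n) t (v 0))" for t
  define I where "I t = enn2real (tail_time P (v n) t (v 0))" for t
  define m' where "m' = m"
  have f: "survive P (v n) t (v 0) = ennreal (f t)" for t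
  proof -
    have "survive P (v n) t (v 0) < \<infinity>" using survive_le_one by (rule le_less_trans) simp
    then show ?thesis by (simp add: f_def)
  qed
  have f0: "0 \<le> f t" and I0: "0 \<le> I t" and f1: "f t \<le> 1" for t
    unfolding f_def I_def by (simp_all add: enn2real_leI survive_le_one)
  have mm: "mean_time P (v n) (v 0) = ennreal m'" using m_finite by (simp add: m'_def)
  have m': "1 < m'" using \<open>1 < m\<close> by (simp add: m'_def)
  have V: "v 0 \<in> V" by (simp add: v_0)
  have upper: "tail_time P (v n) t (v 0) \<le> ennreal ((m' + R) * f t)" for t
  proof -
    have "tail_time P (v n) t (v 0) \<le> (mean_time P (v n) (v 0) + ennreal R) * survive P (v n) t (v 0)"
      using closed return V by (rule tail_time_le)
    also have "\<dots> = ennreal ((m' + R) * f t)"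
      using m' \<open>0 \<le> R\<close> f0[of t] by (simp add: mm f ennreal_mult)
    finally show ?thesis .
  qed
  have I: "tail_time P (v n) t (v 0) = ennreal (I t)" for t
  proof -
    have "tail_time P (v n) t (v 0) < \<infinity>" using upper by (rule le_less_trans) simp
    then show ?thesis by (simp add: I_def)
  qed
  have up: "I t \<le> (m' + R) * f t" for t
    using upper[of t] m' \<open>0 \<le> R\<close> f0[of t] by (simp add: I)
  define b where "b = R / real (Suc u)"
  have "0 \<le> b" using \<open>0 \<le> R\<close> by (simp add: b_def)
  have b: "survive P (v 0) u x \<le> ennreal b" if "x \<in> V" for x
  proof -
    have *: "ennreal (real (Suc u)) * survive P (v 0) u x \<le> ennreal R"
      using survive_markov return[OF that] by (rule order_trans)
    have "survive P (v 0) u x < \<infinity>" using survive_le_one by (rule le_less_trans) simp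
    then obtain s where s: "survive P (v 0) u x = ennreal s" "0 \<le> s"
      by (cases "survive P (v 0) u x") auto
    have "ennreal (real (Suc u) * s) \<le> ennreal R" using * s by (simp only: ennreal_mult of_nat_0_le_iff)
    then have "real (Suc u) * s \<le> R" using \<open>0 \<le> R\<close> by (simp only: ennreal_le_iff)
    then show ?thesis unfolding s b_def by (intro ennreal_leI) (simp add: pos_le_divide_eq mult.commute)
  qed
  have lower: "m' * f (t + u) \<le> m' * b + I t" for t
  proof -
    have "mean_time P (v n) (v 0) * survive P (v n) (t + u) (v 0)
        \<le> mean_time P (v n) (v 0) * ennreal b * survive P (v n) t (v 0) + tail_time P (v n) t (v 0)"
      using closed b V by (rule survive_le_tail_time)
    also have "\<dots> \<le> mean_time P (v n) (v 0) * ennreal b * 1 + tail_time P (v n) t (v 0)"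
      by (intro add_right_mono mult_left_mono survive_le_one) auto
    also have "\<dots> = ennreal (m' * b + I t)"
      using m' \<open>0 \<le> b\<close> I0[of t] by (simp add: mm I ennreal_mult)
    finally have "ennreal (m' * f (t + u)) \<le> ennreal (m' * b + I t)"
      using m' f0[of "t + u"] by (simp add: mm f ennreal_mult)
    then show ?thesis using m' \<open>0 \<le> b\<close> I0[of t] by (subst (asm) ennreal_le_iff) auto
  qed
  have step: "I t = f t + I (Suc t)" for t
  proof -
    have "ennreal (I t) = ennreal (f t + I (Suc t))"
      using tail_time_step[of P "v n" t "v 0"] I0[of "Suc t"] f0[of t] by (simp add: I f)
    then show ?thesis using I0 f0 by (subst (asm) ennreal_inj) auto
  qed
  have "I 0 = m'" by (simp add: I_def m'_def)
  note bounds = survival_bounds[OF step this f0 f1 I0 up lower m' \<open>0 \<le> R\<close> \<open>0 \<le> b\<close>]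
  show "enn2real (survive P (v n) t (v 0)) \<le> exp (- (real t - real u) / (m + R)) + R / real (Suc u)"
    using bounds(1)[of t] unfolding f_def b_def m'_def .
  show "(m * exp (- real t / (m - 1)) - (real u + m * (R / real (Suc u)))) / (m + R)
      \<le> enn2real (survive P (v n) t (v 0))"
    using bounds(2)[of t] unfolding f_def b_def m'_def .
qed

context
  fixes K \<kappa> :: real
  assumes drift: "\<And>b. b \<in> branch C (v 1) \<Longrightarrow> ennreal (death C b) * descent b \<le> ennreal K"
    and death: "\<And>b. b \<in> branch C (v 1) \<Longrightarrow> \<kappa> \<le> death C b"
    and \<kappa>_pos: "0 < \<kappa>" and K_pos: "0 \<le> K"
begin

lemma descent_real:
  assumes "b \<in> branch C (v 1)"
  obtains w where "descent b = ennreal w" "0 \<le> w" "death C b * w \<le> K" "w \<le> K / \<kappa>"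
proof -
  have J: "b \<in> J" using branch_non_root[of "v 1"] v_J n_pos assms by auto
  obtain w where w: "descent b = ennreal w" "0 \<le> w"
    using descent_finite[OF J] by (cases "descent b") auto
  then have *: "death C b * w \<le> K"
    using drift[OF assms] K_pos death_pos[OF J] by (simp flip: ennreal_mult)
  have "\<kappa> * w \<le> death C b * w" using death[OF assms] w by (intro mult_right_mono) auto
  then have "w \<le> K / \<kappa>" using * \<kappa>_pos by (simp add: pos_le_divide_eq mult.commute)
  then show thesis by (rule that[OF w *])
qed

text \<open>The drift bound makes each edge of the branch cost at most K / \<kappa>, which is the bound on the increments of
the mean time to the root along a step of the chain.\<close>

lemma second_moment_bound:
  assumes finite: "\<And>x. x \<in> V \<Longrightarrow> mean_time P (v 0) x < \<infinity>"
  shows "second_moment P (v 0) (v n) \<le> ennreal (G\<^sup>2 + (K / \<kappa>)\<^sup>2 * G)"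
proof -
  have v1: "v 1 \<in> J" "parent C (v 1) = v 0" using v_J v_parent n_pos by auto
  have le: "descent b \<le> ennreal (K / \<kappa>)" if "b \<in> branch C (v 1)" for b
    using descent_real[OF that] by (metis ennreal_leI)
  have from0: "mean_time P (v 0) x = descent x + mean_time P (v 0) (parent C x)"
    if "x \<in> J" for x
    using mean_time_from_branch[OF that branch_self[OF that], of "v 0"] root_notin_branch[OF that] by (simp add: v_0)
  have "second_moment P (v 0) (v n) \<le> (mean_time P (v 0) (v n))\<^sup>2 + (ennreal (K / \<kappa>))\<^sup>2 * mean_time P (v 0) (v n)"
  proof (rule second_moment_le[where A = "branch C (v 1)"])
    show closed: "set_pmf (P x) \<subseteq> insert (v 0) (branch C (v 1))" if "x \<in> branch C (v 1)" for x
      using gate_branch[OF v1(1)] that v1(2) by (auto simp: gate_def)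
    fix x y assume x: "x \<in> branch C (v 1)" and y: "y \<in> set_pmf (P x)"
    have xJ: "x \<in> J" using x branch_non_root[OF v1(1)] by blast
    consider "y = x" | "y = parent C x" | "y \<in> J" "x = parent C y"
      using transitions[OF J_subset[OF xJ] y] by blast
    then show "mean_time P (v 0) y \<le> mean_time P (v 0) x + ennreal (K / \<kappa>) \<and>
        mean_time P (v 0) x \<le> mean_time P (v 0) y + ennreal (K / \<kappa>)"
    proof cases
      case 2
      then show ?thesis using from0[OF xJ] le[OF x]
        by (auto simp: add.commute add_left_mono add_increasing add_increasing2)
    next
      case 3
      then have "y \<in> branch C (v 1)"
        using closed[OF x] y root_path_root by (auto simp: v_0 non_root_def)
      then show ?thesis using from0[OF 3(1)] 3 le
        by (auto simp: add.commute add_left_mono add_increasing add_increasing2)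
    qed simp
  qed (use finite branch_subset v_branch[of 1 n] n_pos in auto)
  also have "\<dots> = ennreal (G\<^sup>2 + (K / \<kappa>)\<^sup>2 * G)"
    using G_finite K_pos \<kappa>_pos by (simp add: ennreal_mult ennreal_plus flip: ennreal_power)
  finally show ?thesis .
qed

text \<open>The drift along the path makes the way out exponentially more expensive, edge by edge, than the way
back, except on the first few edges.\<close>

lemma ascent_vs_descent:
  assumes "1 \<le> K" "0 \<le> c"
  shows "(exp c - 1) * (G - (c + 1) * K\<^sup>2 / \<kappa>) \<le> m"
  unfolding G_eq m_eq
proof (rule reverse_drift_sum)
  define w where "w i = enn2real (descent (v i))" for i
  define r where "r i = enn2real (ascent (v i))" for i
  have w: "ennreal (w i) = descent (v i)" and r: "ennreal (r i) = ascent (v i)" if "1 \<le> i" "i \<le> n" for i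
    using descent_finite ascent_finite v_J[OF that] by (simp_all add: w_def r_def)
  have nonneg: "0 \<le> w i" "0 \<le> r i" for i by (simp_all add: w_def r_def)
  have bounds: "death C (v i) * w i \<le> K \<and> w i \<le> K / \<kappa>" if "1 \<le> i" "i \<le> n" for i
    using descent_real[OF v_branch[of 1 i]] that by (metis (full_types) enn2real_ennreal order_refl w_def)
  show "0 \<le> enn2real (descent (v i)) \<and> enn2real (descent (v i)) \<le> K / \<kappa>" if "1 \<le> i" "i \<le> n" for i
    using bounds[OF that] by (simp add: w_def)
  fix i assume i: "1 \<le> i" "i \<le> n"
  have "(exp ((real i - 1) / K) - 1) * w i \<le> r i"
  proof (rule reverse_drift_growth[where n = n and birth = "\<lambda>i. birth C (v i)" and death = "\<lambda>i. death C (v i)"])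
    fix j assume j: "1 \<le> j" "j < n"
    then have J: "v (Suc j) \<in> J" "v j \<in> J" and p: "parent C (v (Suc j)) = v j"
      using v_J v_Suc_parent by auto
    have pos: "0 < birth C (v (Suc j))" "0 < death C (v j)" using J birth_pos death_pos by auto
    show "1 + birth C (v (Suc j)) * w (Suc j) \<le> death C (v j) * w j"
    proof -
      have "ennreal (1 + birth C (v (Suc j)) * w (Suc j)) \<le> ennreal (death C (v j) * w j)"
        using descent_recursion[of "v (Suc j)"] J p j pos nonneg w[of "Suc j"] w[of j]
        by (simp add: ennreal_mult ennreal_plus)
      then show ?thesis using pos nonneg[of j] by simp
    qed
    show "1 + death C (v j) * r j \<le> birth C (v (Suc j)) * r (Suc j)"
    proof -
      have "ennreal (1 + death C (v j) * r j) \<le> ennreal (birth C (v (Suc j)) * r (Suc j))"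
        using ascent_recursion[of "v (Suc j)"] J p j pos nonneg r[of "Suc j"] r[of j]
        by (simp add: ennreal_mult ennreal_plus)
      then show ?thesis using pos nonneg[of "Suc j"] by simp
    qed
  qed (use bounds nonneg i \<open>1 \<le> K\<close> v_J birth_pos death_pos in auto)
  then show "(exp ((real i - 1) / K) - 1) * enn2real (descent (v i)) \<le> enn2real (ascent (v i))"
    by (simp add: w_def r_def)
qed (use assms \<kappa>_pos in auto)

end

end

section \<open>Cut-off and escape along the family\<close>

text \<open>An infinite numerator is excluded by the bound on the ratio; the maximum is there because ennreal sends
negative numbers to 0.\<close>

lemma le_of_scaled_le:
  assumes "a / ennreal g \<le> ennreal k" "0 < g"
  shows "a \<le> ennreal (max k 0 * g)"
proof (cases a)
  case (real r)
  have "ennreal (r / g) \<le> ennreal k" using real assms by (simp add: divide_ennreal)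
  also have "\<dots> = ennreal (max k 0)" by (simp add: max_def ennreal_neg)
  finally have "ennreal (r / g) \<le> ennreal (max k 0)" .
  then have "r / g \<le> max k 0" by (subst (asm) ennreal_le_iff) simp_all
  then have "r \<le> max k 0 * g" using \<open>0 < g\<close> by (simp add: pos_divide_le_eq)
  then show ?thesis unfolding real by (rule ennreal_leI)
next
  case top
  then show ?thesis using assms by (simp add: divide_ennreal_def inverse_ennreal ennreal_top_mult top_unique)
qed

context bd_family
begin

lemma birth_death_path: "1 \<le> n \<Longrightarrow> birth_death_path (C (v n)) v n"
  using chain[of n] origin_v[of n] path_in[of n] path_parent[of _ n] inj_v
  by unfold_locales (auto simp: birth_death_chain_def)

lemma chain_realisation:
  assumes "1 \<le> n" "x \<in> verts (C (v n))"
  shows "chain_realisation (C (v n)) x (M (v n) x) (X (v n) x)"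
proof -
  interpret birth_death_path "C (v n)" v n by (rule birth_death_path[OF assms(1)])
  show ?thesis using realisation[OF assms] countable_V closed by unfold_locales auto
qed

lemma hit_eq: "hit X a x z = (\<lambda>\<omega>. ennreal_of_enat (hitting_time (X a x) z \<omega>))"
  by (rule ext) (simp add: hit_def)

lemma mean_hit_eq:
  assumes "1 \<le> n" "x \<in> verts (C (v n))"
  shows "mean_hit M X (v n) x z = mean_time (trans_pmf (C (v n))) z x"
  using chain_realisation.mean_hit_time[OF chain_realisation[OF assms]] by (simp add: mean_hit_def hit_eq)

end

theorem theorem2p4:
  fixes v :: "nat \<Rightarrow> 'v"
    and C :: "'v \<Rightarrow> 'v bd_chain"
    and M :: "'v \<Rightarrow> 'v \<Rightarrow> 'w measure"
    and X :: "'v \<Rightarrow> 'v \<Rightarrow> nat \<Rightarrow> 'w \<Rightarrow> 'v"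
    and K K' K\<mu>' :: real
  assumes "bd_family v C M X"
    and "strong_drift v C M X"
    and "\<And>a. a \<in> range v - {v 0} \<Longrightarrow>
           (SUP x\<in>verts (C a). mean_hit M X a x (v 0)) / mean_hit M X a a (v 0) \<le> ennreal K"
    and "\<And>a. a \<in> range v - {v 0} \<Longrightarrow>
           (drift_sup C M X a (non_root (C a)))\<^sup>2 / mean_hit M X a a (v 0) \<le> ennreal K'"
    and "K\<mu>' > 0"
    and "\<And>a. a \<in> range v - {v 0} \<Longrightarrow> (INF b\<in>non_root (C a). death (C a) b) \<ge> K\<mu>'"
  shows "cutoff_at_mean_times (\<lambda>n. M (v n) (v n)) (\<lambda>n. hit X (v n) (v n) (v 0)) \<and>
         escape_at_mean_times (\<lambda>n. M (v n) (v 0)) (\<lambda>n. hit X (v n) (v 0) (v n))"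
proof -
  interpret bd_family v C M X by (rule assms(1))
  define P where "P n = trans_pmf (C (v n))" for n
  define G where "G n = enn2real (mean_time (P n) (v 0) (v n))" for n
  define m where "m n = enn2real (mean_time (P n) (v n) (v 0))" for n
  define D where "D n = drift_sup C M X (v n) (branch (C (v n)) (v 1))" for n
  define k where "k n = enn2real (D n)" for n
  define R where "R n = max K 0 * G n" for n

  have mean_G: "mean_time (P n) (v 0) (v n) = ennreal (G n)" "1 \<le> G n"
    and mean_m: "mean_time (P n) (v n) (v 0) = ennreal (m n)" "real n \<le> m n" if "1 \<le> n" for n
  proof -
    interpret p: birth_death_path "C (v n)" v n by (rule birth_death_path[OF that])
    show "mean_time (P n) (v 0) (v n) = ennreal (G n)" "1 \<le> G n"
      using p.G_finite p.G_ge_1 by (simp_all add: G_def P_def)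
    show "mean_time (P n) (v n) (v 0) = ennreal (m n)" "real n \<le> m n"
      using p.m_finite p.m_ge_n by (simp_all add: m_def P_def)
  qed
  have index: "v n \<in> range v - {v 0}" if "1 \<le> n" for n
    using that injD[OF inj_v, of n 0] by auto
  have alpha: "alpha (C (v n)) (v n) = v 1" if "1 \<le> n" for n
    by (rule birth_death_path.alpha_v[OF birth_death_path[OF that]])
  have return: "mean_time (P n) (v 0) x \<le> ennreal (R n)" if "1 \<le> n" "x \<in> verts (C (v n))" for n x
  proof -
    have "mean_hit M X (v n) x (v 0) \<le> (SUP x\<in>verts (C (v n)). mean_hit M X (v n) x (v 0))"
      using that by (intro SUP_upper)
    then have "mean_hit M X (v n) x (v 0) / mean_hit M X (v n) (v n) (v 0) \<le> ennreal K"
      using assms(3)[OF index[OF that(1)]] by (meson divide_right_mono_ennreal order_trans)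
    then have "mean_time (P n) (v 0) x / ennreal (G n) \<le> ennreal K"
      using that path_in[of n n] mean_G by (simp add: mean_hit_eq flip: P_def)
    then show ?thesis unfolding R_def by (rule le_of_scaled_le) (use mean_G(2)[OF that(1)] in simp)
  qed
  have R0: "0 \<le> R n" for n by (simp add: R_def G_def)

  obtain \<kappa> :: real where \<kappa>: "0 < \<kappa>"
    and inf_death: "\<And>a. a \<in> range v - {v 0} \<Longrightarrow> \<kappa> \<le> (INF b\<in>branch (C a) (alpha (C a) a). death (C a) b)"
    and sd: "(\<lambda>n. (drift_sup C M X (v n) (branch (C (v n)) (alpha (C (v n)) (v n))))\<^sup>2 / mean_hit M X (v n) (v n) (v 0)) \<longlonglongrightarrow> 0"
    using assms(2) unfolding strong_drift_def Let_def by blast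
  have death: "\<kappa> \<le> death (C (v n)) b" if "1 \<le> n" "b \<in> branch (C (v n)) (v 1)" for n b
  proof -
    have "bdd_below (death (C (v n)) ` branch (C (v n)) (v 1))"
      by (rule bdd_belowI[of _ 0]) (auto simp: death_def)
    then have "(INF b\<in>branch (C (v n)) (v 1). death (C (v n)) b) \<le> death (C (v n)) b"
      using that(2) by (rule cINF_lower)
    then show ?thesis using inf_death[OF index[OF that(1)]] alpha[OF that(1)] by simp
  qed
  have n1: "\<forall>\<^sub>F n in sequentially. 1 \<le> (n::nat)" by (rule eventually_ge_at_top)
  have sd': "(\<lambda>n. (D n)\<^sup>2 / ennreal (G n)) \<longlonglongrightarrow> 0"
  proof (rule Lim_transform_eventually[OF sd])
    show "\<forall>\<^sub>F n in sequentially. (drift_sup C M X (v n) (branch (C (v n)) (alpha (C (v n)) (v n))))\<^sup>2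
        / mean_hit M X (v n) (v n) (v 0) = (D n)\<^sup>2 / ennreal (G n)"
      using n1 by eventually_elim (simp add: alpha D_def mean_hit_eq path_in mean_G(1) flip: P_def)
  qed
  \<comment> \<open>An infinite drift constant would make the ratio infinite, because the mean time in its denominator is finite.\<close>
  have finite_D: "\<forall>\<^sub>F n in sequentially. 1 \<le> n \<and> D n = ennreal (k n)"
    using order_tendstoD(2)[OF sd' zero_less_one] n1
  proof eventually_elim
    case (elim n)
    have "D n \<noteq> \<top>"
    proof
      assume "D n = \<top>"
      then show False using elim mean_G(2)[of n]
        by (simp add: power2_eq_square divide_ennreal_def inverse_ennreal ennreal_top_mult)
    qed
    then show ?case using elim by (simp add: k_def less_top)
  qed
  have k: "(\<lambda>n. (k n)\<^sup>2 / G n) \<longlonglongrightarrow> 0"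
  proof (rule Lim_transform_eventually)
    show "(\<lambda>n. enn2real ((D n)\<^sup>2 / ennreal (G n))) \<longlonglongrightarrow> 0"
      using sd' by (intro tendsto_enn2real) auto
    show "\<forall>\<^sub>F n in sequentially. enn2real ((D n)\<^sup>2 / ennreal (G n)) = (k n)\<^sup>2 / G n"
      using finite_D
    proof eventually_elim
      case (elim n)
      have "0 \<le> k n" "0 < G n" using mean_G(2)[of n] elim by (auto simp: k_def)
      then show ?case using elim by (simp add: ennreal_power divide_ennreal)
    qed
  qed
  have drift: "ennreal (death (C (v n)) b) * mean_time (P n) (parent (C (v n)) b) b \<le> ennreal (k n)"
    if "1 \<le> n" "D n = ennreal (k n)" "b \<in> branch (C (v n)) (v 1)" for n b
  proof -
    have "ennreal (death (C (v n)) b) * mean_hit M X (v n) b (parent (C (v n)) b) \<le> D n"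
      unfolding D_def drift_sup_def using that(3) by (rule SUP_upper)
    then show ?thesis using that by (simp add: mean_hit_eq branch_def P_def)
  qed

  have "cutoff_at_mean_times (\<lambda>n. M (v n) (v n)) (\<lambda>n. hit X (v n) (v n) (v 0))"
    unfolding cutoff_at_mean_times_def
  proof (intro allI impI)
    fix \<epsilon> :: real assume "0 < \<epsilon>"
    let ?p = "\<lambda>n. \<P>(\<omega> in M (v n) (v n). \<bar>mean_scaled (M (v n) (v n)) (hit X (v n) (v n) (v 0)) \<omega> - 1\<bar> > \<epsilon>)"
    have "\<forall>\<^sub>F n in sequentially. ?p n \<le> ((k n)\<^sup>2 / G n) / (\<kappa> * \<epsilon>)\<^sup>2"
      using finite_D
    proof eventually_elim
      case (elim n)
      interpret p: birth_death_path "C (v n)" v n by (rule birth_death_path) (use elim in simp)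
      interpret r: chain_realisation "C (v n)" "v n" "M (v n) (v n)" "X (v n) (v n)"
        by (rule chain_realisation) (use elim path_in in auto)
      have G: "1 \<le> G n" using mean_G elim by simp
      have second: "second_moment (P n) (v 0) (v n) \<le> ennreal ((G n)\<^sup>2 + (k n / \<kappa>)\<^sup>2 * G n)"
        unfolding G_def P_def
      proof (rule p.second_moment_bound)
        show "mean_time (trans_pmf (C (v n))) (v 0) x < \<infinity>" if "x \<in> verts (C (v n))" for x
          using return[of n x] elim that by (auto simp: P_def intro: le_less_trans)
      qed (use elim drift death \<kappa> in \<open>auto simp: k_def P_def\<close>)
      have "?p n \<le> (k n / \<kappa>)\<^sup>2 * G n / (\<epsilon> * G n)\<^sup>2"
        unfolding hit_eq
      proof (rule r.mean_scaled_chebyshev[OF r.hit_time_measurable])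
        show "(\<integral>\<^sup>+\<omega>. r.hit_time (v 0) \<omega> \<partial>M (v n) (v n)) = ennreal (G n)"
          using r.mean_hit_time mean_G(1) elim by (simp flip: P_def)
        show "(\<integral>\<^sup>+\<omega>. (r.hit_time (v 0) \<omega>)\<^sup>2 \<partial>M (v n) (v n)) \<le> ennreal ((G n)\<^sup>2 + (k n / \<kappa>)\<^sup>2 * G n)"
          using r.second_moment_hit_time second by (simp only: P_def)
      qed (use G \<open>0 < \<epsilon>\<close> in auto)
      also have "\<dots> = ((k n)\<^sup>2 / G n) / (\<kappa> * \<epsilon>)\<^sup>2"
        using G by (simp add: power_mult_distrib power_divide power2_eq_square)
      finally show ?case .
    qed
    moreover have "(\<lambda>n. ((k n)\<^sup>2 / G n) / (\<kappa> * \<epsilon>)\<^sup>2) \<longlonglongrightarrow> 0"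
      using tendsto_divide[OF k tendsto_const, of "(\<kappa> * \<epsilon>)\<^sup>2"] \<kappa> \<open>0 < \<epsilon>\<close> by simp
    ultimately show "?p \<longlonglongrightarrow> 0"
      by (intro tendsto_sandwich[of "\<lambda>_. 0" ?p]) auto
  qed

  moreover have "escape_at_mean_times (\<lambda>n. M (v n) (v 0)) (\<lambda>n. hit X (v n) (v 0) (v n))"
  proof -
    have "(\<lambda>n. G n / m n) \<longlonglongrightarrow> 0"
    proof (rule ratio_tendsto_0[OF k _ _ \<kappa>])
      show "\<forall>\<^sub>F n in sequentially. 0 < G n"
        using n1 by eventually_elim (use mean_G(2) in \<open>fastforce intro: less_le_trans\<close>)
      fix c :: real assume "0 \<le> c"
      show "\<forall>\<^sub>F n in sequentially. (exp c - 1) * (G n - (c + 1) * (k n)\<^sup>2 / \<kappa>) \<le> m n"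
        using finite_D
      proof eventually_elim
        case (elim n)
        interpret p: birth_death_path "C (v n)" v n by (rule birth_death_path) (use elim in simp)
        have v1: "v 1 \<in> non_root (C (v n))" using p.v_J[of 1] elim by simp
        \<comment> \<open>The drift constant is at least 1, since leaving a vertex takes at least one step.\<close>
        have "ennreal (death (C (v n)) (v 1)) * p.descent (v 1) \<le> ennreal (k n)"
          using drift[OF _ _ p.branch_self[OF v1]] elim by (simp only: P_def)
        with p.one_le_death_descent[OF v1] have "1 \<le> ennreal (k n)" by (rule order_trans)
        then have "1 \<le> k n" by simp
        then show ?case
          unfolding G_def m_def P_def
          by (intro p.ascent_vs_descent) (use elim drift death \<kappa> \<open>0 \<le> c\<close> in \<open>auto simp: P_def\<close>)
      qed
    qed
    then have Rm: "(\<lambda>n. R n / m n) \<longlonglongrightarrow> 0"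
      using tendsto_mult_right_zero[of "\<lambda>n. G n / m n" sequentially "max K 0"] by (simp add: R_def)
    have m_top: "filterlim m at_top sequentially"
      by (rule filterlim_at_top_mono[OF filterlim_real_sequentially])
         (rule eventually_mono[OF n1 mean_m(2)])
    have n2: "\<forall>\<^sub>F n in sequentially. 2 \<le> (n::nat)" by (rule eventually_ge_at_top)
    have survival: "(\<lambda>n. enn2real (survive (P n) (v n) (nat \<lfloor>y * m n\<rfloor>) (v 0))) \<longlonglongrightarrow> exp (- y)"
      if "0 \<le> y" for y
    proof (rule survival_tendsto_exp[OF m_top Rm R0 _ _ that])
      show "\<forall>\<^sub>F n in sequentially. \<forall>t u. enn2real (survive (P n) (v n) t (v 0))
          \<le> exp (- (real t - real u) / (m n + R n)) + R n / real (Suc u)"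
        using n2
      proof (eventually_elim, intro allI)
        fix n t u :: nat assume n: "2 \<le> n"
        interpret p: birth_death_path "C (v n)" v n by (rule birth_death_path) (use n in simp)
        show "enn2real (survive (P n) (v n) t (v 0)) \<le> exp (- (real t - real u) / (m n + R n)) + R n / real (Suc u)"
          unfolding P_def m_def
          by (rule p.survival_estimates(1)) (use n R0 return[of n] mean_m(2)[of n] in \<open>auto simp: P_def m_def\<close>)
      qed
      show "\<forall>\<^sub>F n in sequentially. \<forall>t u.
          (m n * exp (- real t / (m n - 1)) - (real u + m n * (R n / real (Suc u)))) / (m n + R n)
            \<le> enn2real (survive (P n) (v n) t (v 0))"
        using n2
      proof (eventually_elim, intro allI)
        fix n t u :: nat assume n: "2 \<le> n"
        interpret p: birth_death_path "C (v n)" v n by (rule birth_death_path) (use n in simp)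
        show "(m n * exp (- real t / (m n - 1)) - (real u + m n * (R n / real (Suc u)))) / (m n + R n)
            \<le> enn2real (survive (P n) (v n) t (v 0))"
          unfolding P_def m_def
          by (rule p.survival_estimates(2)) (use n R0 return[of n] mean_m(2)[of n] in \<open>auto simp: P_def m_def\<close>)
      qed
    qed
    show ?thesis
      unfolding escape_at_mean_times_def weak_conv_m_def weak_conv_def cdf_exponential
    proof (intro allI impI)
      fix y :: real
      let ?F = "\<lambda>n. cdf (distr (M (v n) (v 0)) borel (mean_scaled (M (v n) (v 0)) (hit X (v n) (v 0) (v n)))) y"
      have "\<forall>\<^sub>F n in sequentially. (if y < 0 then 0
          else 1 - enn2real (survive (P n) (v n) (nat \<lfloor>y * m n\<rfloor>) (v 0))) = ?F n"
        using n1
      proof eventually_elim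
        case (elim n)
        interpret r: chain_realisation "C (v n)" "v 0" "M (v n) (v 0)" "X (v n) (v 0)"
          by (rule chain_realisation) (use elim path_in in auto)
        have meas: "mean_scaled (M (v n) (v 0)) (r.hit_time (v n)) \<in> borel_measurable (M (v n) (v 0))"
          unfolding mean_scaled_def using r.hit_time_measurable by measurable
        have F: "?F n = r.prob {\<omega> \<in> space (M (v n) (v 0)). mean_scaled (M (v n) (v 0)) (r.hit_time (v n)) \<omega> \<le> y}"
          unfolding cdf_def hit_eq by (subst measure_distr[OF meas]) (auto simp: vimage_def Int_def conj_commute)
        show ?case
        proof (cases "y < 0")
          case True
          then have empty: "{\<omega> \<in> space (M (v n) (v 0)). mean_scaled (M (v n) (v 0)) (r.hit_time (v n)) \<omega> \<le> y} = {}"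
            by (auto simp: mean_scaled_def not_le intro: less_le_trans)
          then show ?thesis unfolding F empty using True by simp
        next
          case False
          have "r.prob {\<omega> \<in> space (M (v n) (v 0)). mean_scaled (M (v n) (v 0)) (r.hit_time (v n)) \<omega> \<le> y}
              = 1 - enn2real (survive (P n) (v n) (nat \<lfloor>y * m n\<rfloor>) (v 0))"
            unfolding P_def
            by (rule r.cdf_scaled_hit_time) (use False elim mean_m[of n] in \<open>auto simp: P_def\<close>)
          then show ?thesis unfolding F using False by simp
        qed
      qed
      moreover have "(\<lambda>n. if y < 0 then 0 else 1 - enn2real (survive (P n) (v n) (nat \<lfloor>y * m n\<rfloor>) (v 0)))
          \<longlonglongrightarrow> (if y < 0 then 0 else 1 - exp (- y))"
        using tendsto_diff[OF tendsto_const[of 1] survival[of y]] by (cases "y < 0") auto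
      ultimately show "?F \<longlonglongrightarrow> (if y < 0 then 0 else 1 - exp (- y))"
        by (rule Lim_transform_eventually[rotated])
    qed
  qed
  ultimately show ?thesis ..
qed

end
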